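(* Let $\gamma$ be a positive integer, $P_0$ a continuous distribution on $\mathbb{R}^n$ with density $p_0$, $\varepsilon\ge0$, and $\tilde{\mathcal{P}}$ a class of distributions on $\mathbb{R}^n$ with $N_\gamma(P_0)\subseteq\tilde{\mathcal{P}}$. For $P\in N_\gamma(P_0)$ with density $p$, let $\mathbf{Q}^\star_\varepsilon(P)$ be the distribution with density \[ q(x)=\mathrm{clip}\Big(\tfrac{1}{r_P}p(x);\ \tfrac{\gamma+1}{\gamma+e^\varepsilon}p_0(x),\ \tfrac{(\gamma+1)e^\varepsilon}{\gamma+e^\varepsilon}p_0(x)\Big), \] where $r_P>0$ is the normalizing constant making $\int q=1$. Fix an $f$-divergence $D_f$ and define $\mathbf{Q}^\star_{\varepsilon,N_\gamma(P_0)}(P)=\mathbf{Q}^\star_\varepsilon(P)$ if $P\in N_\gamma(P_0)$ and $=\mathbf{Q}^\star_\varepsilon(\hat P)$ otherwise, where $\hat P\in N_\gamma(P_0)$ minimizes $D_f(P\|P')$ over $P'\in N_\gamma(P_0)$. Then $\mathbf{Q}^\star_{\varepsilon,N_\gamma(P_0)}\in\mathcal{Q}_{\mathbb{R}^n,\tilde{\mathcal{P}},\varepsilon}$ and \[ \sup_{P\in N_\gamma(P_0)}D_f\big(P\|\mathbf{Q}^\star_{\varepsilon,N_\gamma(P_0)}(P)\big)=\mathcal{R}\big(\mathcal{Q}_{\mathbb{R}^n,\tilde{\mathcal{P}},\varepsilon},N_\gamma(P_0),f\big). \]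
   Context: $\mathrm{clip}(x;s_1,s_2)=\max\{s_1,\min\{s_2,x\}\}$. For $\gamma\ge1$, $E_\gamma(P\|Q)=\mathbb{E}_Q[\max\{\frac{dP}{dQ}-\gamma,0\}]$ and $N_\gamma(P_0)=\{P:E_\gamma(P\|P_0)=E_\gamma(P_0\|P)=0\}$, equivalently the $P\ll P_0$ with $\frac1\gamma\le\frac{dP}{dP_0}\le\gamma$. A sampler $\mathbf{Q}:\tilde{\mathcal{P}}\to\mathcal{P}(\mathbb{R}^n)$ is $\varepsilon$-LDP if $\mathbf{Q}(P)(A)\le e^\varepsilon\mathbf{Q}(P')(A)$ for all $P,P'\in\tilde{\mathcal{P}}$ and measurable $A$; $\mathcal{Q}_{\mathbb{R}^n,\tilde{\mathcal{P}},\varepsilon}$ is the set of such samplers. $D_f(P\|Q)=\int qf(p/q)$ for convex $f:(0,\infty)\to\mathbb{R}$, $f(1)=0$ (conventions $f(0)=\lim_{t\to0^+}f(t)$, $0f(0/0)=0$, $0f(a/0)=a\lim_{u\to\infty}f(u)/u$). $\mathcal{R}(\mathcal{Q}_{\mathbb{R}^n,\tilde{\mathcal{P}},\varepsilon},N_\gamma(P_0),f)=\inf_{\mathbf{Q}\in\mathcal{Q}_{\mathbb{R}^n,\tilde{\mathcal{P}},\varepsilon}}\sup_{P\in N_\gamma(P_0)}D_f(P\|\mathbf{Q}(P))$. *)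

theory Defs
  imports "HOL-Probability.Probability"
begin

definition dists :: "'a::euclidean_space measure set" where
  "dists = {M. prob_space M \<and> sets M = sets borel}"

definition clip :: "real \<Rightarrow> real \<Rightarrow> real \<Rightarrow> real" where
  "clip x s1 s2 = max s1 (min s2 x)"

definition Ngamma :: "real \<Rightarrow> 'a::euclidean_space measure \<Rightarrow> 'a measure set" where
  "Ngamma g P0 = {P \<in> dists. absolutely_continuous P0 P \<and>
      (AE x in P0. ennreal (1 / g) \<le> RN_deriv P0 P x \<and> RN_deriv P0 P x \<le> ennreal g)}"

definition samplers :: "'a::euclidean_space measure set \<Rightarrow> real \<Rightarrow> ('a measure \<Rightarrow> 'a measure) set" where
  "samplers Pt eps = {Q. (\<forall>P\<in>Pt. Q P \<in> dists) \<and>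
      (\<forall>P\<in>Pt. \<forall>P'\<in>Pt. \<forall>A\<in>sets borel. emeasure (Q P) A \<le> ennreal (exp eps) * emeasure (Q P') A)}"

definition fdiv_integrand :: "(real \<Rightarrow> real) \<Rightarrow> real \<Rightarrow> real \<Rightarrow> ereal" where
  "fdiv_integrand f p q =
     (if q > 0 then (if p > 0 then ereal (q * f (p / q))
                     else ereal q * Lim (at_right 0) (\<lambda>t. ereal (f t)))
      else if p > 0 then ereal p * Lim at_top (\<lambda>u. ereal (f u / u))
      else 0)"

definition mix_measure :: "'a measure \<Rightarrow> 'a measure \<Rightarrow> 'a measure" where
  "mix_measure P Q = measure_of (space P) (sets P) (\<lambda>A. emeasure P A + emeasure Q A)"

definition Df :: "(real \<Rightarrow> real) \<Rightarrow> 'a measure \<Rightarrow> 'a measure \<Rightarrow> ereal" where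
  "Df f P Q =
    (let \<mu> = mix_measure P Q;
         h = (\<lambda>x. fdiv_integrand f (enn2real (RN_deriv \<mu> P x)) (enn2real (RN_deriv \<mu> Q x)))
     in enn2ereal (\<integral>\<^sup>+x. e2ennreal (h x) \<partial>\<mu>) - enn2ereal (\<integral>\<^sup>+x. e2ennreal (- h x) \<partial>\<mu>))"

definition Qstar :: "real \<Rightarrow> real \<Rightarrow> ('a::euclidean_space \<Rightarrow> real) \<Rightarrow> 'a measure \<Rightarrow> 'a measure" where
  "Qstar g eps p0 P =
    (let p = (\<lambda>x. enn2real (RN_deriv lborel P x));
         q = (\<lambda>r x. clip (p x / r) ((g + 1) / (g + exp eps) * p0 x)
                               ((g + 1) * exp eps / (g + exp eps) * p0 x));
         r = (SOME r. r > 0 \<and> (\<integral>\<^sup>+x. ennreal (q r x) \<partial>lborel) = 1)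
     in density lborel (\<lambda>x. ennreal (q r x)))"

definition minimax :: "'a::euclidean_space measure set \<Rightarrow> 'a measure set \<Rightarrow> real \<Rightarrow> (real \<Rightarrow> real) \<Rightarrow> ereal" where
  "minimax Pt N eps f = (INF Q\<in>samplers Pt eps. SUP P\<in>N. Df f P (Q P))"

end

theory Submission
  imports Defs
begin

text \<open>
  Write \<open>E = exp eps\<close>, \<open>a = (g + 1) / (g + E)\<close>, \<open>b = E * a\<close>, and let \<open>t\<close> be the density of \<open>P\<close> with
  respect to \<open>P0\<close>, so that the sampler returns \<open>s = clip (t / r) a b\<close>. If \<open>E \<le> g\<^sup>2\<close>, the ratio \<open>t / s\<close>
  lies between \<open>m = 1 / (g * a)\<close> and \<open>m' = g / b\<close>, since these two values of \<open>r\<close> give total mass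
  at least and at most one. Bounding \<open>f\<close> by its chord over \<open>[m, m']\<close> and using that \<open>t\<close> and \<open>s\<close> both
  have mean one bounds the divergence by \<open>V = w * f m' + (1 - w) * f m\<close> with \<open>w = E / (g + E)\<close>.

  Conversely, split the space into \<open>g + 1\<close> sets of equal \<open>P0\<close>-mass, which is possible as \<open>P0\<close> has no atoms,
  and let \<open>P\<^sub>i\<close> have density \<open>g\<close> on the \<open>i\<close>-th set and \<open>1 / g\<close> elsewhere. Privacy forces some
  \<open>Q (P\<^sub>i)\<close> to give the \<open>i\<close>-th set mass at most \<open>w\<close>, and the tangents of \<open>f\<close> at \<open>m'\<close> on that set
  and at \<open>m\<close> off it show that the divergence is then at least \<open>V\<close>. If \<open>E > g\<^sup>2\<close>, the sampler returns
  \<open>P\<close> itself and the value is zero.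
\<close>

section \<open>Convex functions and the divergence integrand\<close>

text \<open>Since \<open>f 1 = 0\<close>, the chord from \<open>t\<close> to 1 has slope
  \<open>- f t / (1 - t)\<close>. By convexity \<open>f t / (1 - t)\<close> grows as
  \<open>t\<close> decreases to 0, so it converges to its supremum, possibly infinite. Without a
  limit, \<open>Lim\<close> in \<open>fdiv_integrand\<close> would be an unspecified value.\<close>

lemma convex_tendsto_at_right_0:
  fixes f :: "real \<Rightarrow> real"
  assumes "convex_on {0<..} f" "f 1 = 0"
  shows "\<exists>l. ((\<lambda>t. ereal (f t)) \<longlongrightarrow> l) (at_right 0)"
proof -
  define \<phi> where "\<phi> t = f t / (1 - t)" for t
  have dec: "\<phi> t \<le> \<phi> s" if "0 < s" "s \<le> t" "t < 1" for s t
  proof (cases "s = t")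
    case False
    then have "(f s - f 1) / (s - 1) \<le> (f t - f 1) / (t - 1)"
      using that by (intro convex_on_slope_le[OF assms(1)]) auto
    then show ?thesis
      using minus_divide_divide[of "f s" "1 - s"] minus_divide_divide[of "f t" "1 - t"] assms(2)
        divide_minus_right[of "f s" "1 - s"] divide_minus_right[of "f t" "1 - t"]
      by (simp add: \<phi>_def)
  qed simp
  define l where "l = (SUP t\<in>{0<..<1}. ereal (\<phi> t))"
  have "((\<lambda>t. ereal (\<phi> t)) \<longlongrightarrow> l) (at_right 0)"
  proof (rule increasing_tendsto)
    show "\<forall>\<^sub>F t in at_right 0. ereal (\<phi> t) \<le> l"
      unfolding eventually_at_right_field l_def by (intro exI[of _ 1]) (auto intro!: SUP_upper)
    fix x assume "x < l"
    then obtain t where t: "t \<in> {0<..<1}" "x < ereal (\<phi> t)"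
      unfolding l_def less_SUP_iff by auto
    have "x < ereal (\<phi> s)" if "0 < s" "s < t" for s
      using dec[of s t] that t by (auto intro: less_le_trans)
    with t show "\<forall>\<^sub>F t in at_right 0. x < ereal (\<phi> t)"
      unfolding eventually_at_right_field by auto
  qed
  moreover have "((\<lambda>t. ereal (1 - t)) \<longlongrightarrow> ereal (1 - 0)) (at_right 0)"
    by (intro tendsto_intros)
  ultimately have "((\<lambda>t. ereal (1 - t) * ereal (\<phi> t)) \<longlongrightarrow> ereal (1 - 0) * l) (at_right 0)"
    by (intro tendsto_mult_ereal) auto
  moreover have "\<forall>\<^sub>F t in at_right 0. ereal (1 - t) * ereal (\<phi> t) = ereal (f t)"
    unfolding eventually_at_right_field by (intro exI[of _ 1]) (auto simp: \<phi>_def)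
  ultimately show ?thesis
    by (intro exI) (rule Lim_transform_eventually)
qed

text \<open>Mirror image at infinity: for \<open>t > 1\<close> the chord slope
  \<open>f t / (t - 1)\<close> is nondecreasing, and it differs from \<open>f t / t\<close> by a
  factor tending to 1.\<close>

lemma convex_slope_tendsto_at_top:
  fixes f :: "real \<Rightarrow> real"
  assumes "convex_on {0<..} f" "f 1 = 0"
  shows "\<exists>l. ((\<lambda>u. ereal (f u / u)) \<longlongrightarrow> l) at_top"
proof -
  define \<phi> where "\<phi> t = f t / (t - 1)" for t
  have inc: "\<phi> s \<le> \<phi> t" if "1 < s" "s \<le> t" for s t
  proof (cases "s = t")
    case False
    then have "(f 1 - f s) / (1 - s) \<le> (f 1 - f t) / (1 - t)"
      using that by (intro convex_on_slope_le[OF assms(1)]) auto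
    then show ?thesis
      using minus_divide_divide[of "f s" "s - 1"] minus_divide_divide[of "f t" "t - 1"] assms(2)
      by (simp add: \<phi>_def)
  qed simp
  define l where "l = (SUP t\<in>{1<..}. ereal (\<phi> t))"
  have "((\<lambda>t. ereal (\<phi> t)) \<longlongrightarrow> l) at_top"
  proof (rule increasing_tendsto)
    show "\<forall>\<^sub>F t in at_top. ereal (\<phi> t) \<le> l"
      using eventually_gt_at_top[of 1] by eventually_elim (auto simp: l_def intro!: SUP_upper)
    fix x assume "x < l"
    then obtain t where t: "t > 1" "x < ereal (\<phi> t)"
      unfolding l_def less_SUP_iff by auto
    show "\<forall>\<^sub>F s in at_top. x < ereal (\<phi> s)"
      using eventually_ge_at_top[of t]
    proof eventually_elim
      case (elim s) then show ?case using inc[of t s] t by (auto intro: less_le_trans)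
    qed
  qed
  moreover have "((\<lambda>t::real. 1 - 1 / t) \<longlongrightarrow> 1 - 0) at_top"
    by (intro tendsto_diff tendsto_const tendsto_divide_0[OF tendsto_const] filterlim_ident
        filterlim_at_top_imp_at_infinity)
  then have "((\<lambda>t::real. ereal (1 - 1 / t)) \<longlongrightarrow> ereal 1) at_top"
    by simp
  ultimately have "((\<lambda>t. ereal (1 - 1 / t) * ereal (\<phi> t)) \<longlongrightarrow> ereal 1 * l) at_top"
    by (intro tendsto_mult_ereal) auto
  moreover have "\<forall>\<^sub>F t in at_top. ereal (1 - 1 / t) * ereal (\<phi> t) = ereal (f t / t)"
    using eventually_gt_at_top[of 1] by eventually_elim (auto simp: \<phi>_def field_simps)
  ultimately show ?thesis
    by (intro exI) (rule Lim_transform_eventually)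
qed

text \<open>Scaling the affine bound by \<open>q\<close> gives the interior case. On the boundary
  the bound survives in the limit: \<open>d\<close> bounds the limit of \<open>f\<close> at 0, and
  \<open>c\<close> bounds the slope at infinity.\<close>

lemma fdiv_integrand_ge:
  assumes f: "convex_on {0<..} f" "f 1 = 0"
    and minorant: "\<And>u. 0 < u \<Longrightarrow> c * u + d \<le> f u" and nonneg: "0 \<le> p" "0 \<le> q"
  shows "ereal (c * p + d * q) \<le> fdiv_integrand f p q"
proof -
  consider "q > 0" "p > 0" | "q > 0" "p = 0" | "q = 0" "p > 0" | "q = 0" "p = 0"
    using nonneg by fastforce
  then show ?thesis
  proof cases
    case 1
    then have "q * (c * (p / q) + d) \<le> q * f (p / q)"
      by (intro mult_left_mono minorant) auto
    with 1 show ?thesis by (simp add: fdiv_integrand_def algebra_simps)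
  next
    case 2
    obtain l where l: "((\<lambda>t. ereal (f t)) \<longlongrightarrow> l) (at_right 0)"
      using convex_tendsto_at_right_0[OF f] by blast
    have "((\<lambda>t. ereal (c * t + d)) \<longlongrightarrow> ereal (c * 0 + d)) (at_right 0)"
      by (intro tendsto_intros)
    moreover have "\<forall>\<^sub>F t in at_right 0. ereal (c * t + d) \<le> ereal (f t)"
      unfolding eventually_at_right_field using minorant by (intro exI[of _ 1]) auto
    ultimately have "ereal (c * 0 + d) \<le> l"
      by (rule tendsto_le[OF trivial_limit_at_right_real l])
    then have "ereal q * ereal d \<le> ereal q * l"
      using 2 by (intro ereal_mult_left_mono) simp_all
    with 2 show ?thesis
      using tendsto_Lim[OF trivial_limit_at_right_real l] by (simp add: fdiv_integrand_def mult.commute)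
  next
    case 3
    obtain l where l: "((\<lambda>u. ereal (f u / u)) \<longlongrightarrow> l) at_top"
      using convex_slope_tendsto_at_top[OF f] by blast
    have "((\<lambda>u::real. c + d / u) \<longlongrightarrow> c + 0) at_top"
      by (intro tendsto_add tendsto_const tendsto_divide_0[OF tendsto_const] filterlim_ident
          filterlim_at_top_imp_at_infinity)
    then have "((\<lambda>u::real. ereal (c + d / u)) \<longlongrightarrow> ereal c) at_top"
      by simp
    moreover have "\<forall>\<^sub>F u in at_top. ereal (c + d / u) \<le> ereal (f u / u)"
      using eventually_gt_at_top[of 0]
    proof eventually_elim
      case (elim u)
      then show ?case using divide_right_mono[OF minorant[of u], of u] by (simp add: add_divide_distrib)
    qed
    ultimately have "ereal c \<le> l"
      by (rule tendsto_le[OF trivial_limit_at_top_linorder l])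
    then have "ereal p * ereal c \<le> ereal p * l"
      using 3 by (intro ereal_mult_left_mono) auto
    with 3 show ?thesis
      using tendsto_Lim[OF trivial_limit_at_top_linorder l] by (simp add: fdiv_integrand_def mult.commute)
  next
    case 4
    then show ?thesis by (simp add: fdiv_integrand_def zero_ereal_def)
  qed
qed

text \<open>The tangent slope is chosen as a function of the base point, so that slopes at equal points
  agree.\<close>

lemma convex_support_lines:
  fixes f :: "real \<Rightarrow> real"
  assumes "convex_on {0<..} f"
  obtains k where "\<And>x u. 0 < x \<Longrightarrow> 0 < u \<Longrightarrow> f x + k x * (u - x) \<le> f u"
proof -
  have "f x + Inf ((\<lambda>t. (f x - f t) / (x - t)) ` ({x<..} \<inter> {0<..})) * (u - x) \<le> f u"
    if "0 < x" "0 < u" for x u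
    using convex_le_Inf_differential[OF assms, of x u] that by (simp add: interior_open)
  then show thesis by (rule that)
qed

section \<open>Bounds for f-divergences\<close>

text \<open>\<open>Df\<close> subtracts the integral of a negative part from that of a positive part
  in \<open>ereal\<close>. The two parts are compared separately, since monotonicity of the
  nonnegative integral asks for no measurability of \<open>h\<close>.\<close>

lemma integral_le_ereal_integral:
  fixes h :: "'a \<Rightarrow> ereal"
  assumes L: "integrable M L" and le: "AE x in M. ereal (L x) \<le> h x"
  shows "ereal (integral\<^sup>L M L) \<le>
    enn2ereal (\<integral>\<^sup>+x. e2ennreal (h x) \<partial>M) - enn2ereal (\<integral>\<^sup>+x. e2ennreal (- h x) \<partial>M)"
proof -
  have fin: "(\<integral>\<^sup>+x. ennreal (L x) \<partial>M) \<noteq> \<infinity>" "(\<integral>\<^sup>+x. ennreal (- L x) \<partial>M) \<noteq> \<infinity>"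
    using L by (auto simp: real_integrable_def)
  have "ereal (integral\<^sup>L M L) = enn2ereal (\<integral>\<^sup>+x. ennreal (L x) \<partial>M) - enn2ereal (\<integral>\<^sup>+x. ennreal (- L x) \<partial>M)"
    unfolding real_lebesgue_integral_def[OF L]
    using fin by (cases "\<integral>\<^sup>+x. ennreal (L x) \<partial>M"; cases "\<integral>\<^sup>+x. ennreal (- L x) \<partial>M") auto
  also have "\<dots> \<le> enn2ereal (\<integral>\<^sup>+x. e2ennreal (h x) \<partial>M) - enn2ereal (\<integral>\<^sup>+x. e2ennreal (- h x) \<partial>M)"
  proof (intro ereal_minus_mono)
    show "enn2ereal (\<integral>\<^sup>+x. ennreal (L x) \<partial>M) \<le> enn2ereal (\<integral>\<^sup>+x. e2ennreal (h x) \<partial>M)"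
      unfolding less_eq_ennreal.rep_eq[symmetric]
      by (intro nn_integral_mono_AE, use le in eventually_elim) (metis e2ennreal_ereal e2ennreal_mono)
    show "enn2ereal (\<integral>\<^sup>+x. e2ennreal (- h x) \<partial>M) \<le> enn2ereal (\<integral>\<^sup>+x. ennreal (- L x) \<partial>M)"
      unfolding less_eq_ennreal.rep_eq[symmetric]
      by (intro nn_integral_mono_AE, use le in eventually_elim)
        (metis e2ennreal_ereal e2ennreal_mono ereal_minus_le_minus uminus_ereal.simps(1))
  qed
  finally show ?thesis .
qed

lemma ereal_integral_le_integral:
  fixes h :: "'a \<Rightarrow> ereal"
  assumes U: "integrable M U" and le: "AE x in M. h x \<le> ereal (U x)"
  shows "enn2ereal (\<integral>\<^sup>+x. e2ennreal (h x) \<partial>M) - enn2ereal (\<integral>\<^sup>+x. e2ennreal (- h x) \<partial>M)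
    \<le> ereal (integral\<^sup>L M U)"
proof -
  have fin: "(\<integral>\<^sup>+x. ennreal (U x) \<partial>M) \<noteq> \<infinity>" "(\<integral>\<^sup>+x. ennreal (- U x) \<partial>M) \<noteq> \<infinity>"
    using U by (auto simp: real_integrable_def)
  have "enn2ereal (\<integral>\<^sup>+x. e2ennreal (h x) \<partial>M) - enn2ereal (\<integral>\<^sup>+x. e2ennreal (- h x) \<partial>M) \<le>
    enn2ereal (\<integral>\<^sup>+x. ennreal (U x) \<partial>M) - enn2ereal (\<integral>\<^sup>+x. ennreal (- U x) \<partial>M)"
  proof (intro ereal_minus_mono)
    show "enn2ereal (\<integral>\<^sup>+x. e2ennreal (h x) \<partial>M) \<le> enn2ereal (\<integral>\<^sup>+x. ennreal (U x) \<partial>M)"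
      unfolding less_eq_ennreal.rep_eq[symmetric]
      by (intro nn_integral_mono_AE, use le in eventually_elim) (metis e2ennreal_ereal e2ennreal_mono)
    show "enn2ereal (\<integral>\<^sup>+x. ennreal (- U x) \<partial>M) \<le> enn2ereal (\<integral>\<^sup>+x. e2ennreal (- h x) \<partial>M)"
      unfolding less_eq_ennreal.rep_eq[symmetric]
      by (intro nn_integral_mono_AE, use le in eventually_elim)
        (metis e2ennreal_ereal e2ennreal_mono ereal_minus_le_minus uminus_ereal.simps(1))
  qed
  also have "\<dots> = ereal (integral\<^sup>L M U)"
    unfolding real_lebesgue_integral_def[OF U]
    using fin by (cases "\<integral>\<^sup>+x. ennreal (U x) \<partial>M"; cases "\<integral>\<^sup>+x. ennreal (- U x) \<partial>M") auto
  finally show ?thesis .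
qed

section \<open>The sum of two distributions as a dominating measure\<close>

lemma sets_mix_measure [simp, measurable_cong]: "sets (mix_measure P Q) = sets P"
  by (simp add: mix_measure_def)

lemma emeasure_mix_measure:
  assumes "sets Q = sets P" "A \<in> sets P"
  shows "emeasure (mix_measure P Q) A = emeasure P A + emeasure Q A"
  unfolding mix_measure_def
proof (rule emeasure_measure_of_sigma)
  show "sigma_algebra (space P) (sets P)" ..
  show "positive (sets P) (\<lambda>A. emeasure P A + emeasure Q A)"
    by (auto simp: positive_def)
  show "countably_additive (sets P) (\<lambda>A. emeasure P A + emeasure Q A)"
  proof (rule countably_additiveI)
    fix F :: "nat \<Rightarrow> 'a set" assume F: "range F \<subseteq> sets P" "disjoint_family F"
    then show "(\<Sum>i. emeasure P (F i) + emeasure Q (F i)) = emeasure P (\<Union> (range F)) + emeasure Q (\<Union> (range F))"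
      using assms(1) by (simp add: suminf_add[symmetric] suminf_emeasure)
  qed
qed fact

lemma finite_measure_mix_measure:
  assumes "finite_measure P" "finite_measure Q" "sets Q = sets P"
  shows "finite_measure (mix_measure P Q)"
proof
  have "space Q = space P" by (rule sets_eq_imp_space_eq[OF assms(3)])
  then show "emeasure (mix_measure P Q) (space (mix_measure P Q)) \<noteq> \<infinity>"
    using finite_measure.emeasure_finite[OF assms(1), of "space P"]
      finite_measure.emeasure_finite[OF assms(2), of "space P"]
      emeasure_mix_measure[OF assms(3), of "space P"]
    by (simp add: mix_measure_def)
qed

lemma absolutely_continuous_mix_measure:
  assumes "sets Q = sets P"
  shows "absolutely_continuous (mix_measure P Q) P" "absolutely_continuous (mix_measure P Q) Q"
  using assms by (auto simp: absolutely_continuous_def null_sets_def emeasure_mix_measure)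

text \<open>\<open>enn2real\<close> maps infinity to 0, which loses nothing here: the derivative of
  a finite measure is finite almost everywhere.\<close>

lemma (in sigma_finite_measure) has_bochner_integral_RN_deriv:
  assumes N: "finite_measure N" "absolutely_continuous M N" "sets N = sets M" and A: "A \<in> sets M"
  shows "has_bochner_integral M (\<lambda>x. indicator A x * enn2real (RN_deriv M N x)) (measure N A)"
proof (rule has_bochner_integral_nn_integral)
  interpret N: finite_measure N by fact
  have fin: "AE x in M. RN_deriv M N x \<noteq> \<infinity>"
    by (rule RN_deriv_finite[OF _ N(2,3)]) unfold_locales
  have "(\<integral>\<^sup>+x. ennreal (indicator A x * enn2real (RN_deriv M N x)) \<partial>M) = (\<integral>\<^sup>+x. RN_deriv M N x * indicator A x \<partial>M)"
    by (intro nn_integral_cong_AE, use fin in eventually_elim)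
      (auto simp: indicator_def ennreal_enn2real_if)
  also have "\<dots> = emeasure (density M (RN_deriv M N)) A"
    using A by (simp add: emeasure_density)
  also have "\<dots> = ennreal (measure N A)"
    using N by (simp add: density_RN_deriv N.emeasure_eq_measure)
  finally show "(\<integral>\<^sup>+x. ennreal (indicator A x * enn2real (RN_deriv M N x)) \<partial>M) = ennreal (measure N A)" .
qed (use A in auto)

lemma distsD:
  assumes "P \<in> dists"
  shows "prob_space P" "finite_measure P" "sets P = sets borel" "space P = UNIV"
  using assms sets_eq_imp_space_eq[of P borel] prob_space.finite_measure by (auto simp: dists_def)

lemma has_bochner_integral_mix_RN_deriv:
  assumes "P \<in> dists" "Q \<in> dists" "A \<in> sets borel"
  shows "has_bochner_integral (mix_measure P Q)
      (\<lambda>x. indicator A x * enn2real (RN_deriv (mix_measure P Q) P x)) (measure P A)"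
    "has_bochner_integral (mix_measure P Q)
      (\<lambda>x. indicator A x * enn2real (RN_deriv (mix_measure P Q) Q x)) (measure Q A)"
proof -
  note P = distsD[OF assms(1)] and Q = distsD[OF assms(2)]
  have eq: "sets Q = sets P" using P Q by simp
  interpret mix: finite_measure "mix_measure P Q"
    by (rule finite_measure_mix_measure[OF P(2) Q(2) eq])
  show "has_bochner_integral (mix_measure P Q)
      (\<lambda>x. indicator A x * enn2real (RN_deriv (mix_measure P Q) P x)) (measure P A)"
    "has_bochner_integral (mix_measure P Q)
      (\<lambda>x. indicator A x * enn2real (RN_deriv (mix_measure P Q) Q x)) (measure Q A)"
    using P Q eq assms(3) absolutely_continuous_mix_measure[OF eq]
    by (auto intro!: mix.has_bochner_integral_RN_deriv)
qed

text \<open>This replaces data processing to the binary channel given by \<open>A\<close>: the binary divergence is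
  evaluated through two affine minorants, so that \<open>Q\<close> need not be dominated by anything.\<close>

lemma Df_ge:
  assumes P: "P \<in> dists" and Q: "Q \<in> dists" and A: "A \<in> sets borel"
    and f: "convex_on {0<..} f" "f 1 = 0"
    and minorant1: "\<And>u. 0 < u \<Longrightarrow> c1 * u + d1 \<le> f u"
    and minorant2: "\<And>u. 0 < u \<Longrightarrow> c2 * u + d2 \<le> f u"
  shows "ereal (c1 * measure P A + d1 * measure Q A
      + c2 * (1 - measure P A) + d2 * (1 - measure Q A)) \<le> Df f P Q"
proof -
  define \<mu> where "\<mu> = mix_measure P Q"
  define p where "p x = enn2real (RN_deriv \<mu> P x)" for x
  define q where "q x = enn2real (RN_deriv \<mu> Q x)" for x
  \<comment> \<open>The first minorant is used on \<open>A\<close> and the second off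
    \<open>A\<close>, so the integral of \<open>L\<close> depends on \<open>P\<close> and
    \<open>Q\<close> only through their masses on \<open>A\<close>.\<close>
  define L where "L x = c1 * (indicator A x * p x) + d1 * (indicator A x * q x)
      + c2 * (indicator (- A) x * p x) + d2 * (indicator (- A) x * q x)" for x
  have A': "- A \<in> sets borel" using A by auto
  note int = has_bochner_integral_mix_RN_deriv[OF P Q A, folded \<mu>_def, folded p_def q_def]
    has_bochner_integral_mix_RN_deriv[OF P Q A', folded \<mu>_def, folded p_def q_def]
  have "measure P (- A) = 1 - measure P A" "measure Q (- A) = 1 - measure Q A"
    using prob_space.prob_compl[of P A] prob_space.prob_compl[of Q A] A distsD[OF P] distsD[OF Q]
    by (auto simp: Compl_eq_Diff_UNIV)
  moreover have "has_bochner_integral \<mu> L (c1 * measure P A + d1 * measure Q A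
      + c2 * measure P (- A) + d2 * measure Q (- A))"
    unfolding L_def
    by (intro has_bochner_integral_add has_bochner_integral_mult_right) (rule int)+
  ultimately have L: "integrable \<mu> L" "integral\<^sup>L \<mu> L = c1 * measure P A + d1 * measure Q A
      + c2 * (1 - measure P A) + d2 * (1 - measure Q A)"
    by (simp_all add: has_bochner_integral_iff)
  have "ereal (L x) \<le> fdiv_integrand f (p x) (q x)" for x
  proof (cases "x \<in> A")
    case True
    then show ?thesis
      using fdiv_integrand_ge[OF f minorant1, of "p x" "q x"] by (simp add: L_def p_def q_def)
  next
    case False
    then show ?thesis
      using fdiv_integrand_ge[OF f minorant2, of "p x" "q x"] by (simp add: L_def p_def q_def)
  qed
  then show ?thesis
    using integral_le_ereal_integral[OF L(1), of "\<lambda>x. fdiv_integrand f (p x) (q x)"] L(2)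
    by (simp add: Df_def Let_def p_def q_def \<mu>_def)
qed

text \<open>An affine bound for \<open>f\<close> at the ratios \<open>t / s\<close> bounds the
  integrand by \<open>c * p + d * q\<close>, and \<open>p\<close> and \<open>q\<close> both
  integrate to one. The work lies in passing from the base measure \<open>M\<close> to the mixture
  used in \<open>Df\<close>.\<close>

lemma Df_density_le:
  fixes t s :: "'a::euclidean_space \<Rightarrow> real"
  assumes M: "sigma_finite_measure M" and P: "P \<in> dists" and Q: "Q \<in> dists"
    and t: "t \<in> borel_measurable M" "P = density M t"
    and s: "s \<in> borel_measurable M" "Q = density M s"
    and pos: "AE x in M. 0 < t x \<and> 0 < s x"
    and le: "AE x in M. f (t x / s x) \<le> c * (t x / s x) + d"
  shows "Df f P Q \<le> ereal (c + d)"
proof -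
  define \<mu> where "\<mu> = mix_measure P Q"
  define p where "p x = enn2real (RN_deriv \<mu> P x)" for x
  define q where "q x = enn2real (RN_deriv \<mu> Q x)" for x
  have sets: "sets Q = sets P" "sets M = sets P" using t s by simp_all
  have [measurable]: "t \<in> borel_measurable M" "s \<in> borel_measurable M" by fact+
  \<comment> \<open>Relative to this density of the mixture, \<open>P\<close> and \<open>Q\<close>
    have derivatives \<open>t / (t + s)\<close> and \<open>s / (t + s)\<close>, whose quotient is
    again \<open>t / s\<close>.\<close>
  have \<mu>: "\<mu> = density M (\<lambda>x. ennreal (t x + s x))"
  proof (rule measure_eqI)
    fix A assume "A \<in> sets \<mu>"
    then have A [measurable]: "A \<in> sets M" "A \<in> sets P" using sets by (auto simp: \<mu>_def)
    have "emeasure \<mu> A = (\<integral>\<^sup>+x. ennreal (t x) * indicator A x \<partial>M) + (\<integral>\<^sup>+x. ennreal (s x) * indicator A x \<partial>M)"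
      using A emeasure_mix_measure[OF sets(1) A(2)]
      by (simp add: \<mu>_def emeasure_density t(2) s(2))
    also have "\<dots> = (\<integral>\<^sup>+x. ennreal (t x + s x) * indicator A x \<partial>M)"
      using pos by (subst nn_integral_add[symmetric], simp, simp, intro nn_integral_cong_AE)
        (elim eventually_mono, simp add: distrib_right)
    also have "\<dots> = emeasure (density M (\<lambda>x. ennreal (t x + s x))) A"
      by (simp add: emeasure_density)
    finally show "emeasure \<mu> A = emeasure (density M (\<lambda>x. ennreal (t x + s x))) A" .
  qed (simp add: \<mu>_def sets)
  interpret mix: finite_measure \<mu>
    unfolding \<mu>_def by (rule finite_measure_mix_measure[OF distsD(2)[OF P] distsD(2)[OF Q] sets(1)])
  have posmu: "AE x in \<mu>. 0 < t x \<and> 0 < s x"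
    unfolding \<mu> using pos by (subst AE_density) (auto elim: eventually_mono)
  have lemu: "AE x in \<mu>. f (t x / s x) \<le> c * (t x / s x) + d"
    unfolding \<mu> using le by (subst AE_density) (auto elim: eventually_mono)
  have ratio_t: "AE x in M. ennreal (t x + s x) * ennreal (t x / (t x + s x)) = ennreal (t x)"
    using pos by eventually_elim (simp del: ennreal_plus flip: ennreal_mult)
  have ratio_s: "AE x in M. ennreal (t x + s x) * ennreal (s x / (t x + s x)) = ennreal (s x)"
    using pos by eventually_elim (simp del: ennreal_plus flip: ennreal_mult)
  have "density \<mu> (\<lambda>x. ennreal (t x / (t x + s x))) = P"
    unfolding \<mu> t(2)
    using ratio_t by (subst density_density_eq) (auto intro!: density_cong simp del: ennreal_plus)
  moreover have "density \<mu> (\<lambda>x. ennreal (s x / (t x + s x))) = Q"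
    unfolding \<mu> s(2)
    using ratio_s by (subst density_density_eq) (auto intro!: density_cong simp del: ennreal_plus)
  moreover have "(\<lambda>x. ennreal (t x / (t x + s x))) \<in> borel_measurable \<mu>"
      "(\<lambda>x. ennreal (s x / (t x + s x))) \<in> borel_measurable \<mu>"
    unfolding \<mu> by simp_all
  ultimately have RN: "AE x in \<mu>. ennreal (t x / (t x + s x)) = RN_deriv \<mu> P x"
      "AE x in \<mu>. ennreal (s x / (t x + s x)) = RN_deriv \<mu> Q x"
    by (intro mix.RN_deriv_unique; simp)+
  have "AE x in \<mu>. fdiv_integrand f (p x) (q x) \<le> ereal (c * p x + d * q x)"
    using RN posmu lemu
  proof eventually_elim
    case (elim x)
    then have pq: "p x = t x / (t x + s x)" "q x = s x / (t x + s x)"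
      by (simp_all add: p_def q_def flip: elim(1,2))
    have "0 < p x" "0 < q x" "p x / q x = t x / s x"
      using elim(3) unfolding pq by auto
    note pos_pq = this
    then have "q x * f (p x / q x) \<le> q x * (c * (p x / q x) + d)"
      using elim by (intro mult_left_mono) auto
    also have "\<dots> = c * p x + d * q x"
      using pos_pq(2) by (simp add: field_simps)
    finally show ?case using pos_pq(1,2) by (simp add: fdiv_integrand_def)
  qed
  moreover have "has_bochner_integral \<mu> (\<lambda>x. c * p x + d * q x) (c * measure P UNIV + d * measure Q UNIV)"
    using has_bochner_integral_mix_RN_deriv[OF P Q, of UNIV, folded \<mu>_def, folded p_def q_def]
    by (intro has_bochner_integral_add has_bochner_integral_mult_right) simp_all
  moreover have "measure P UNIV = 1" "measure Q UNIV = 1"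
    using prob_space.prob_space[of P] prob_space.prob_space[of Q] distsD[OF P] distsD[OF Q] by auto
  ultimately show ?thesis
    using ereal_integral_le_integral[of \<mu> "\<lambda>x. c * p x + d * q x" "\<lambda>x. fdiv_integrand f (p x) (q x)"]
    by (simp add: has_bochner_integral_iff Df_def Let_def p_def q_def \<mu>_def)
qed

section \<open>Normalized clipping\<close>

lemma clip_bounds: "a \<le> b \<Longrightarrow> a \<le> clip x a b" "a \<le> b \<Longrightarrow> clip x a b \<le> b"
  by (auto simp: clip_def)

lemma clip_mono: "x \<le> y \<Longrightarrow> clip x a b \<le> clip y a b"
  by (auto simp: clip_def)

lemma clip_scale:
  assumes "0 \<le> c"
  shows "clip (c * x) (c * a) (c * b) = c * clip x a b"
  using assms by (simp add: clip_def min_mult_distrib_left max_mult_distrib_left)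

lemma borel_measurable_clip [measurable]:
  "h \<in> borel_measurable M \<Longrightarrow> (\<lambda>x. clip (h x) a b) \<in> borel_measurable M"
  unfolding clip_def by (intro borel_measurable_max borel_measurable_min borel_measurable_const)

lemma (in prob_space) integrable_clip:
  assumes "h \<in> borel_measurable M" "a \<le> b"
  shows "integrable M (\<lambda>x. clip (h x) a b)"
proof (rule integrable_const_bound[where B = "max \<bar>a\<bar> \<bar>b\<bar>"])
  have "\<bar>clip y a b\<bar> \<le> max \<bar>a\<bar> \<bar>b\<bar>" for y
    using clip_bounds[of a b y] assms(2) by linarith
  then show "AE x in M. norm (clip (h x) a b) \<le> max \<bar>a\<bar> \<bar>b\<bar>" by simp
qed (use assms in measurable)

text \<open>Intermediate value theorem in \<open>r\<close>: at \<open>r = 1 / (g * b)\<close>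
  everything is clipped to \<open>b\<close>, at \<open>r = g / a\<close> everything is clipped to
  \<open>a\<close>, and \<open>a \<le> 1 \<le> b\<close>. Continuity in between is dominated
  convergence with bound \<open>b\<close>.\<close>

lemma (in prob_space) clip_normalizer_exists:
  fixes t :: "'a \<Rightarrow> real"
  assumes t [measurable]: "t \<in> borel_measurable M"
    and g: "1 \<le> g" and bounds: "AE x in M. 1 / g \<le> t x \<and> t x \<le> g"
    and ab: "0 < a" "a \<le> 1" "1 \<le> b"
  shows "\<exists>r>0. expectation (\<lambda>x. clip (t x / r) a b) = 1"
proof -
  define F where "F r = expectation (\<lambda>x. clip (t x / r) a b)" for r
  have "AE x in M. clip (t x / (1 / (g * b))) a b = b"
    using bounds
  proof eventually_elim
    case (elim x)
    then have "b \<le> t x / (1 / (g * b))" using g ab by (simp add: field_simps)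
    then show ?case using ab by (simp add: clip_def)
  qed
  then have "F (1 / (g * b)) = expectation (\<lambda>x. b)"
    unfolding F_def by (intro integral_cong_AE) simp_all
  then have F1: "1 \<le> F (1 / (g * b))" using ab prob_space by simp
  have "AE x in M. clip (t x / (g / a)) a b = a"
    using bounds
  proof eventually_elim
    case (elim x)
    then have "t x / (g / a) \<le> a" using g ab by (simp add: field_simps)
    then show ?case using ab by (simp add: clip_def)
  qed
  then have "F (g / a) = expectation (\<lambda>x. a)"
    unfolding F_def by (intro integral_cong_AE) simp_all
  then have F2: "F (g / a) \<le> 1" using ab prob_space by simp
  have "continuous_on {1 / (g * b)..g / a} F"
  proof (rule continuous_on_sequentiallyI)
    fix u :: "nat \<Rightarrow> real" and r assume r: "r \<in> {1 / (g * b)..g / a}" and u: "u \<longlonglongrightarrow> r"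
    have "0 < r" using r g ab by (auto intro: less_le_trans[of 0 "1 / (g * b)"])
    show "(\<lambda>n. F (u n)) \<longlonglongrightarrow> F r"
      unfolding F_def
    proof (rule integral_dominated_convergence[where w = "\<lambda>_. b"])
      show "AE x in M. (\<lambda>n. clip (t x / u n) a b) \<longlonglongrightarrow> clip (t x / r) a b"
        unfolding clip_def using u \<open>0 < r\<close> by (intro AE_I2 tendsto_intros) auto
      show "AE x in M. norm (clip (t x / u n) a b) \<le> b" for n
        using clip_bounds[of a b] ab by (intro AE_I2) (smt (verit) real_norm_def)
    qed simp_all
  qed
  moreover have "1 / (g * b) \<le> g / a"
  proof -
    have "1 / (g * b) \<le> 1" using g ab mult_mono[of 1 g 1 b] by simp
    also have "1 \<le> g / a" using g ab by simp
    finally show ?thesis by simp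
  qed
  ultimately obtain r where "1 / (g * b) \<le> r" "F r = 1"
    using IVT2'[of F "g / a" 1 "1 / (g * b)"] F1 F2 by auto
  moreover have "0 < 1 / (g * b)" using g ab by simp
  ultimately show ?thesis
    unfolding F_def by (metis less_le_trans)
qed

text \<open>The normalizing constant need not be unique, but every choice gives almost everywhere the same
  density as one in any interval that is known to contain a normalizing constant.\<close>

lemma (in prob_space) clip_normalizer_between:
  fixes t :: "'a \<Rightarrow> real"
  assumes t [measurable]: "t \<in> borel_measurable M" and nonneg: "AE x in M. 0 \<le> t x"
    and ab: "a \<le> b" and mM: "0 < m" "m \<le> m'"
    and le: "expectation (\<lambda>x. clip (t x / m') a b) \<le> 1"
    and ge: "1 \<le> expectation (\<lambda>x. clip (t x / m) a b)"
    and r: "0 < r" "expectation (\<lambda>x. clip (t x / r) a b) = 1"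
  obtains \<rho> where "m \<le> \<rho>" "\<rho> \<le> m'" "AE x in M. clip (t x / r) a b = clip (t x / \<rho>) a b"
proof -
  have int: "integrable M (\<lambda>x. clip (t x / s) a b)" for s
    using ab by (intro integrable_clip) simp_all
  \<comment> \<open>Enlarging the divisor lowers the clipped function. If its mean does not drop,
    the difference is nonnegative with integral zero, hence vanishes almost everywhere.\<close>
  have eq: "AE x in M. clip (t x / s) a b = clip (t x / s') a b"
    if s: "0 < s'" "s' \<le> s"
      and i: "expectation (\<lambda>x. clip (t x / s') a b) \<le> expectation (\<lambda>x. clip (t x / s) a b)"
    for s s'
  proof -
    have mono: "AE x in M. clip (t x / s) a b \<le> clip (t x / s') a b"
      using nonneg
    proof eventually_elim
      case (elim x)
      then show ?case using s by (intro clip_mono divide_left_mono) auto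
    qed
    have "expectation (\<lambda>x. clip (t x / s') a b - clip (t x / s) a b) = 0"
      using i integral_mono_AE[OF int int mono] int by (subst Bochner_Integration.integral_diff) auto
    then have "AE x in M. clip (t x / s') a b - clip (t x / s) a b = 0"
      using mono int by (subst (asm) integral_nonneg_eq_0_iff_AE) auto
    then show ?thesis by eventually_elim simp
  qed
  consider "r < m" | "m \<le> r" "r \<le> m'" | "m' < r" by linarith
  then show thesis
  proof cases
    case 1
    then have "AE x in M. clip (t x / m) a b = clip (t x / r) a b"
      using r ge by (intro eq) auto
    then show thesis using mM by (intro that[of m]) (auto elim: eventually_mono)
  next
    case 2
    then show thesis by (intro that[of r]) auto
  next
    case 3
    then have "AE x in M. clip (t x / r) a b = clip (t x / m') a b"
      using r le mM by (intro eq) auto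
    then show thesis using mM by (intro that[of m']) auto
  qed
qed

text \<open>Replace \<open>r\<close> by some \<open>\<rho>\<close> in \<open>[m, m']\<close>. Where
  nothing is clipped the ratio is \<open>\<rho>\<close>. Where the value is raised to
  \<open>a\<close>, the ratio is at most \<open>\<rho>\<close> and at least
  \<open>(1 / g) / a\<close>; where it is lowered to \<open>b\<close>, the ratio is at least
  \<open>\<rho>\<close> and at most \<open>g / b\<close>.\<close>

lemma (in prob_space) clip_ratio_bounds:
  fixes t :: "'a \<Rightarrow> real"
  assumes t [measurable]: "t \<in> borel_measurable M"
    and g: "1 \<le> g" and bounds: "AE x in M. 1 / g \<le> t x \<and> t x \<le> g"
    and ab: "0 < a" "a \<le> b" and mM: "0 < m" "m \<le> m'"
    and ends: "m * a \<le> 1 / g" "g \<le> m' * b"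
    and le: "expectation (\<lambda>x. clip (t x / m') a b) \<le> 1"
    and ge: "1 \<le> expectation (\<lambda>x. clip (t x / m) a b)"
    and r: "0 < r" "expectation (\<lambda>x. clip (t x / r) a b) = 1"
  shows "AE x in M. m \<le> t x / clip (t x / r) a b \<and> t x / clip (t x / r) a b \<le> m'"
proof -
  have nonneg: "AE x in M. 0 \<le> t x"
    using bounds g by (auto elim!: eventually_mono intro: order_trans[of 0 "1 / g"])
  obtain \<rho> where \<rho>: "m \<le> \<rho>" "\<rho> \<le> m'" "AE x in M. clip (t x / r) a b = clip (t x / \<rho>) a b"
    using clip_normalizer_between[OF t nonneg ab(2) mM le ge r] by blast
  from \<rho>(3) bounds nonneg show ?thesis
  proof eventually_elim
    case (elim x)
    define s where "s = clip (t x / \<rho>) a b"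
    have s: "0 < s" "s \<le> max a (t x / \<rho>)" "min b (t x / \<rho>) \<le> s"
      using ab clip_bounds(1)[of a b "t x / \<rho>"] by (auto simp: s_def clip_def)
    have "m * (t x / \<rho>) \<le> \<rho> * (t x / \<rho>)" "\<rho> * (t x / \<rho>) \<le> m' * (t x / \<rho>)"
      using elim mM \<rho> by (intro mult_right_mono; simp)+
    then have q: "m * (t x / \<rho>) \<le> t x" "t x \<le> m' * (t x / \<rho>)"
      using mM \<rho> by simp_all
    have "m * s \<le> m * max a (t x / \<rho>)"
      using s mM by (intro mult_left_mono) auto
    also have "\<dots> \<le> t x"
      using q ends elim by (auto simp: max_def)
    finally have 1: "m * s \<le> t x" .
    have "t x \<le> m' * min b (t x / \<rho>)"
      using q ends elim by (auto simp: min_def)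
    also have "\<dots> \<le> m' * s"
      using s mM by (intro mult_left_mono) auto
    finally have "t x \<le> m' * s" .
    with 1 s show ?case
      unfolding elim(1) s_def[symmetric] by (simp add: pos_le_divide_eq pos_divide_le_eq)
  qed
qed

text \<open>Both clipped functions take the values \<open>a\<close> and \<open>b\<close> at \<open>1 / g\<close> and \<open>g\<close>; the first is convex, the
  second concave, and so their common chord separates them.\<close>

lemma clip_chord:
  fixes g a b :: real
  assumes g: "1 \<le> g" and ab: "0 < a" "a \<le> b" "b \<le> g\<^sup>2 * a" "g * a + b = g + 1"
  obtains k where "a + k * (1 - 1 / g) = 1"
    and "\<And>y. 1 / g \<le> y \<Longrightarrow> y \<le> g \<Longrightarrow> clip (y / (g / b)) a b \<le> a + k * (y - 1 / g)"
    and "\<And>y. 1 / g \<le> y \<Longrightarrow> y \<le> g \<Longrightarrow> a + k * (y - 1 / g) \<le> clip (y / (1 / (g * a))) a b"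
proof (cases "g = 1")
  case True
  with ab have "a = 1" "b = 1" by auto
  then show thesis using True by (intro that[of 0]) (auto simp: clip_def)
next
  case False
  then have "g > 1" using g by simp
  then have d: "0 < g - 1 / g" by (simp add: field_simps less_1_mult)
  define k where "k = (b - a) / (g - 1 / g)"
  \<comment> \<open>The point 1 is the average of \<open>1 / g\<close> and \<open>g\<close> with
    weights \<open>g / (g + 1)\<close> and \<open>1 / (g + 1)\<close>, so
    \<open>g * a + b = g + 1\<close> puts the chord through (1, 1). Composed with a density of mean
    one, it then has integral one.\<close>
  have "g - 1 / g = (g + 1) * (1 - 1 / g)" "b - a = (g + 1) * (1 - a)"
    using \<open>g > 1\<close> ab(4) by (simp_all add: field_simps)
  then have "k * (1 - 1 / g) = 1 - a"
    using \<open>g > 1\<close> by (simp add: k_def)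
  then have norm: "a + k * (1 - 1 / g) = 1"
    by simp
  have "clip (y / (g / b)) a b \<le> a + k * (y - 1 / g) \<and>
      a + k * (y - 1 / g) \<le> clip (y / (1 / (g * a))) a b" if y: "1 / g \<le> y" "y \<le> g" for y
  proof -
    define \<theta> where "\<theta> = (y - 1 / g) / (g - 1 / g)"
    have \<theta>: "0 \<le> \<theta>" "\<theta> \<le> 1" using y d by (auto simp: \<theta>_def)
    have k: "a + k * (y - 1 / g) = (1 - \<theta>) * a + \<theta> * b"
      by (simp add: k_def \<theta>_def algebra_simps diff_divide_distrib)
    have "\<theta> * (g - 1 / g) = y - 1 / g" using d by (simp add: \<theta>_def)
    then have y_eq: "y = (1 - \<theta>) * (1 / g) + \<theta> * g" by (simp add: algebra_simps diff_divide_distrib)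
    \<comment> \<open>Here and for the second bound \<open>b \<le> g\<^sup>2 * a\<close> is
      decisive. Over \<open>[1 / g, g]\<close> the unclipped lines run from
      \<open>b / g\<^sup>2\<close> to \<open>b\<close> and from \<open>a\<close> to
      \<open>g\<^sup>2 * a\<close>, below and above the chord from \<open>a\<close> to
      \<open>b\<close>.\<close>
    have "(1 - \<theta>) * (b / g\<^sup>2) \<le> (1 - \<theta>) * a"
      using \<theta> ab \<open>g > 1\<close> by (intro mult_left_mono) (auto simp: field_simps)
    moreover have "y / (g / b) = (1 - \<theta>) * (b / g\<^sup>2) + \<theta> * b"
      using \<open>g > 1\<close> by (subst y_eq) (simp add: field_simps power2_eq_square)
    ultimately have 1: "y / (g / b) \<le> a + k * (y - 1 / g)" unfolding k by simp
    have "\<theta> * b \<le> \<theta> * (g\<^sup>2 * a)" using \<theta> ab by (intro mult_left_mono) auto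
    moreover have "y / (1 / (g * a)) = (1 - \<theta>) * a + \<theta> * (g\<^sup>2 * a)"
      using \<open>g > 1\<close> by (subst y_eq) (simp add: field_simps power2_eq_square)
    ultimately have 2: "a + k * (y - 1 / g) \<le> y / (1 / (g * a))" unfolding k by simp
    have "\<theta> * a \<le> \<theta> * b" "(1 - \<theta>) * a \<le> (1 - \<theta>) * b"
      using \<theta> ab by (auto intro: mult_left_mono)
    then have "a \<le> a + k * (y - 1 / g)" "a + k * (y - 1 / g) \<le> b"
      unfolding k by (auto simp: algebra_simps)
    with 1 2 show ?thesis by (auto simp: clip_def)
  qed
  with norm show thesis by (intro that[of k]) auto
qed

section \<open>Densities in the neighbourhood\<close>

text \<open>The upper bound rules out infinity almost everywhere, so the derivative may be replaced
  by a real function that is nonnegative everywhere.\<close>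

lemma Ngamma_density:
  assumes P0: "P0 \<in> dists" and g: "0 < g" and P: "P \<in> Ngamma g P0"
  obtains t where "t \<in> borel_measurable borel" "\<And>x. 0 \<le> t x" "P = density P0 (\<lambda>x. ennreal (t x))"
    "AE x in P0. 1 / g \<le> t x \<and> t x \<le> g" "integral\<^sup>L P0 t = 1"
proof -
  define t where "t x = enn2real (RN_deriv P0 P x)" for x
  note P0 = distsD[OF P0]
  interpret P0: prob_space P0 by fact
  from P have P: "P \<in> dists" "absolutely_continuous P0 P"
    and bounds: "AE x in P0. ennreal (1 / g) \<le> RN_deriv P0 P x \<and> RN_deriv P0 P x \<le> ennreal g"
    by (auto simp: Ngamma_def)
  note Pd = distsD[OF P(1)]
  have meas: "t \<in> borel_measurable borel"
  proof -
    have [measurable]: "RN_deriv P0 P \<in> borel_measurable borel"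
      using borel_measurable_RN_deriv[of P0 P] measurable_cong_sets[OF P0(3) refl] by blast
    show ?thesis unfolding t_def by measurable
  qed
  have ge: "ennreal (t x) = RN_deriv P0 P x \<and> 1 / g \<le> t x \<and> t x \<le> g"
    if "ennreal (1 / g) \<le> RN_deriv P0 P x \<and> RN_deriv P0 P x \<le> ennreal g" for x
    using that g by (cases "RN_deriv P0 P x") (auto simp: t_def top_unique)
  have AE_t: "AE x in P0. ennreal (t x) = RN_deriv P0 P x \<and> 1 / g \<le> t x \<and> t x \<le> g"
    using bounds by eventually_elim (rule ge)
  have meas0: "t \<in> borel_measurable P0"
    using meas measurable_cong_sets[OF P0(3) refl] by blast
  have "P = density P0 (RN_deriv P0 P)"
    using P(2) Pd P0 by (simp add: P0.density_RN_deriv)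
  also have "\<dots> = density P0 (\<lambda>x. ennreal (t x))"
    using AE_t meas0 by (intro density_cong) (auto elim: eventually_mono)
  finally have eq: "P = density P0 (\<lambda>x. ennreal (t x))" .
  have "has_bochner_integral P0 (\<lambda>x. indicator UNIV x * t x) (measure P UNIV)"
    unfolding t_def using P Pd P0 by (intro P0.has_bochner_integral_RN_deriv) auto
  then have "integral\<^sup>L P0 t = 1"
    using prob_space.prob_space[OF Pd(1)] Pd by (simp add: has_bochner_integral_iff)
  then show thesis
    using meas eq AE_t by (intro that[of t]) (auto simp: t_def)
qed

lemma density_in_Ngamma:
  assumes P0: "P0 \<in> dists" and t: "t \<in> borel_measurable P0"
    and bounds: "\<And>x. 1 / g \<le> t x" "\<And>x. t x \<le> g" and prob: "prob_space (density P0 (\<lambda>x. ennreal (t x)))"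
  shows "density P0 (\<lambda>x. ennreal (t x)) \<in> Ngamma g P0"
proof -
  note P0 = distsD[OF P0]
  interpret P0: prob_space P0 by fact
  have "AE x in P0. ennreal (t x) = RN_deriv P0 (density P0 (\<lambda>x. ennreal (t x))) x"
    using t by (intro P0.RN_deriv_unique) auto
  then have "AE x in P0. ennreal (1 / g) \<le> RN_deriv P0 (density P0 (\<lambda>x. ennreal (t x))) x \<and>
      RN_deriv P0 (density P0 (\<lambda>x. ennreal (t x))) x \<le> ennreal g"
  proof eventually_elim
    case (elim x)
    then show ?case using bounds[of x] by (metis ennreal_leI)
  qed
  then show ?thesis
    using prob P0 t absolutely_continuousI_density[of "\<lambda>x. ennreal (t x)" P0]
    by (simp add: Ngamma_def dists_def)
qed

text \<open>\<open>Qstar\<close> is built from Lebesgue densities. As \<open>p = p0 * t\<close> and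
  clipping is homogeneous, \<open>p0\<close> factors out and only \<open>t\<close> is clipped,
  between constants, relative to \<open>P0\<close>. The choice by \<open>SOME\<close> is meaningful
  because \<open>clip_normalizer_exists\<close> supplies a candidate.\<close>

lemma Qstar_density:
  fixes p0 t :: "'a::euclidean_space \<Rightarrow> real" and g eps :: real
  defines "P0 \<equiv> density lborel (\<lambda>x. ennreal (p0 x))"
  defines "a \<equiv> (g + 1) / (g + exp eps)" and "b \<equiv> (g + 1) * exp eps / (g + exp eps)"
  assumes p0 [measurable]: "p0 \<in> borel_measurable borel" and p0_nonneg: "\<And>x. 0 \<le> p0 x"
    and prob: "prob_space P0" and g: "1 \<le> g" and eps: "0 \<le> eps"
    and t [measurable]: "t \<in> borel_measurable borel" and t_nonneg: "\<And>x. 0 \<le> t x"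
    and bounds: "AE x in P0. 1 / g \<le> t x \<and> t x \<le> g"
  obtains r where "0 < r" "(\<integral>x. clip (t x / r) a b \<partial>P0) = 1"
    "Qstar g eps p0 (density P0 (\<lambda>x. ennreal (t x))) = density P0 (\<lambda>x. ennreal (clip (t x / r) a b))"
proof -
  interpret P0: prob_space P0 by fact
  define P where "P = density P0 (\<lambda>x. ennreal (t x))"
  define p where "p x = enn2real (RN_deriv lborel P x)" for x
  define q where "q r x = clip (p x / r) (a * p0 x) (b * p0 x)" for r x
  have E: "1 \<le> exp eps" using eps by simp
  have ab: "0 < a" "a \<le> 1" "1 \<le> b"
    using E g mult_left_mono[OF E, of g] by (simp_all add: a_def b_def field_simps add_nonneg_pos)
  then have "a \<le> b" by simp
  note ab = ab this
  have meas [measurable]: "t \<in> borel_measurable P0" by (simp add: P0_def)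
  have "P = density lborel (\<lambda>x. ennreal (p0 x) * ennreal (t x))"
    unfolding P_def P0_def by (subst density_density_eq) auto
  then have "AE x in lborel. ennreal (p0 x) * ennreal (t x) = RN_deriv lborel P x"
    by (intro sigma_finite_measure.RN_deriv_unique[OF sigma_finite_lborel]) auto
  then have p: "AE x in lborel. p x = p0 x * t x"
  proof eventually_elim
    case (elim x)
    then show ?case
      using p0_nonneg t_nonneg by (simp add: p_def enn2real_mult flip: elim)
  qed
  have q: "AE x in lborel. q r x = p0 x * clip (t x / r) a b" for r
    using p
  proof eventually_elim
    case (elim x)
    then show ?case
      using clip_scale[OF p0_nonneg[of x], of "t x / r" a b] by (simp add: q_def mult.commute)
  qed
  have clip_nonneg: "0 \<le> clip y a b" for y
    using clip_bounds(1)[of a b y] ab by linarith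
  have "(\<integral>\<^sup>+x. ennreal (q r x) \<partial>lborel) = (\<integral>\<^sup>+x. ennreal (p0 x) * ennreal (clip (t x / r) a b) \<partial>lborel)" for r
    using q[of r] clip_nonneg p0_nonneg
    by (intro nn_integral_cong_AE) (auto simp: ennreal_mult elim!: eventually_mono)
  also have "\<And>r. \<dots> r = (\<integral>\<^sup>+x. ennreal (clip (t x / r) a b) \<partial>P0)"
    unfolding P0_def by (subst nn_integral_density) auto
  also have "\<And>r. \<dots> r = ennreal (\<integral>x. clip (t x / r) a b \<partial>P0)"
    using clip_nonneg ab by (intro nn_integral_eq_integral P0.integrable_clip) auto
  finally have int_q: "(\<integral>\<^sup>+x. ennreal (q r x) \<partial>lborel) = ennreal (\<integral>x. clip (t x / r) a b \<partial>P0)" for r .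
  define r where "r = (SOME r. r > 0 \<and> (\<integral>\<^sup>+x. ennreal (q r x) \<partial>lborel) = 1)"
  have "\<exists>r>0. (\<integral>x. clip (t x / r) a b \<partial>P0) = 1"
    by (rule P0.clip_normalizer_exists[OF meas g bounds ab(1-3)])
  then have "\<exists>r. r > 0 \<and> (\<integral>\<^sup>+x. ennreal (q r x) \<partial>lborel) = 1"
    unfolding int_q by auto
  then have r: "r > 0" "(\<integral>\<^sup>+x. ennreal (q r x) \<partial>lborel) = 1"
    using someI_ex[of "\<lambda>r. r > 0 \<and> (\<integral>\<^sup>+x. ennreal (q r x) \<partial>lborel) = 1"] by (auto simp: r_def)
  have "Qstar g eps p0 P = density lborel (\<lambda>x. ennreal (q r x))"
    unfolding Qstar_def Let_def p_def[symmetric] a_def[symmetric] b_def[symmetric] q_def[symmetric] r_def ..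
  also have "\<dots> = density lborel (\<lambda>x. ennreal (p0 x) * ennreal (clip (t x / r) a b))"
  proof (rule density_cong)
    have "p \<in> borel_measurable lborel" unfolding p_def by measurable
    then show "(\<lambda>x. ennreal (q r x)) \<in> borel_measurable lborel"
      unfolding q_def clip_def by simp
    show "AE x in lborel. ennreal (q r x) = ennreal (p0 x) * ennreal (clip (t x / r) a b)"
      using q[of r] by eventually_elim (simp add: ennreal_mult clip_nonneg p0_nonneg)
  qed simp
  also have "\<dots> = density P0 (\<lambda>x. ennreal (clip (t x / r) a b))"
    unfolding P0_def by (subst density_density_eq) auto
  finally show thesis
    using r by (intro that[of r]) (auto simp: int_q P_def ennreal_eq_1)
qed

text \<open>Hyperplanes are Lebesgue null, so a coordinate has a continuous distribution function
  under \<open>P0\<close>, and half-spaces cut at its quantiles have the required masses. A chain is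
  produced rather than a partition so that measures of successive differences telescope.\<close>

lemma equal_mass_chain:
  fixes P0 :: "'a::euclidean_space measure"
  assumes P0: "P0 \<in> dists" and ac: "absolutely_continuous lborel P0" and n: "0 < n"
  obtains B :: "nat \<Rightarrow> 'a set" where "\<And>k. B k \<in> sets borel" "\<And>k. B k \<subseteq> B (Suc k)"
    "B 0 = {}" "B n = UNIV" "\<And>k. k \<le> n \<Longrightarrow> measure P0 (B k) = k / n"
proof -
  note P0 = distsD[OF P0]
  interpret P0: prob_space P0 by fact
  obtain e :: 'a where e: "e \<in> Basis" using nonempty_Basis by blast
  define X where "X x = x \<bullet> e" for x
  have X: "X \<in> borel_measurable P0"
  proof -
    have "X \<in> borel_measurable borel" unfolding X_def by measurable
    then show ?thesis using measurable_cong_sets[OF P0(3) refl] by blast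
  qed
  define D where "D = distr P0 borel X"
  interpret D: real_distribution D
    unfolding D_def using X by (rule P0.real_distribution_distr)
  have cdf: "cdf D y = measure P0 {x. X x \<le> y}" for y
    using P0 X by (simp add: cdf_def D_def measure_distr vimage_def)
  have null: "measure D {y} = 0" for y
  proof -
    have "{x. e \<bullet> x = y} \<in> null_sets (completion lborel)"
      using negligible_hyperplane[of e y] nonzero_Basis[OF e] by (simp add: negligible_iff_null_sets)
    moreover have "{x. e \<bullet> x = y} \<in> sets lborel"
      by (simp add: borel_closed closed_hyperplane)
    ultimately have "{x. e \<bullet> x = y} \<in> null_sets P0"
      using ac by (auto simp: null_sets_completion_iff absolutely_continuous_def)
    then have "measure P0 {x. e \<bullet> x = y} = 0"
      by (intro measure_eq_0_null_sets)
    then have "measure P0 {x. X x = y} = 0"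
      by (simp add: X_def inner_commute)
    then show ?thesis
      using P0 X by (simp add: D_def measure_distr vimage_def)
  qed
  have cont: "isCont (cdf D) y" for y
    using null by (simp add: D.isCont_cdf)
  have ex: "\<exists>y. cdf D y = u" if u: "0 < u" "u < 1" for u
  proof -
    obtain y1 where y1: "cdf D y1 < u"
      using order_tendstoD(2)[OF D.cdf_lim_at_bot u(1)] by (auto simp: eventually_at_bot_linorder)
    obtain y2 where y2: "u < cdf D y2"
      using order_tendstoD(1)[OF D.cdf_lim_at_top_prob u(2)] by (auto simp: eventually_at_top_linorder)
    have "y1 \<le> y2" using y1 y2 D.cdf_nondecreasing[of y2 y1] by linarith
    then show ?thesis
      using IVT[of "cdf D" y1 u y2] y1 y2 cont by auto
  qed
  define y where "y k = (SOME y. cdf D y = real k / real n)" for k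
  have y: "cdf D (y k) = k / n" if "0 < k" "k < n" for k
    unfolding y_def by (rule someI_ex, rule ex) (use that in auto)
  \<comment> \<open>The two ends are set by hand, because the distribution function need not attain
    0 or 1 at a real point.\<close>
  define B where "B k = (if k = 0 then {} else if n \<le> k then UNIV else {x. X x \<le> y k})" for k
  show thesis
  proof (rule that)
    show "B k \<in> sets borel" for k
      using X P0 by (auto simp: B_def X_def)
    show "B k \<subseteq> B (Suc k)" for k
    proof -
      have "y k \<le> y (Suc k)" if k: "0 < k" "Suc k < n"
      proof (rule ccontr)
        assume "\<not> y k \<le> y (Suc k)"
        then have "cdf D (y (Suc k)) \<le> cdf D (y k)" by (intro D.cdf_nondecreasing) auto
        then show False using k y[of k] y[of "Suc k"] by (simp add: divide_le_cancel)
      qed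
      then show ?thesis by (auto simp: B_def intro: order_trans)
    qed
    show "measure P0 (B k) = k / n" if "k \<le> n" for k
      using that n y[of k] P0.prob_space P0(4) by (auto simp: B_def cdf)
  qed (use n in \<open>auto simp: B_def\<close>)
qed

section \<open>The clipped sampler\<close>

lemma density_le_density:
  assumes [measurable]: "s \<in> borel_measurable M" "s' \<in> borel_measurable M" "A \<in> sets M"
    and le: "\<And>x. s x \<le> c * s' x"
  shows "emeasure (density M s) A \<le> c * emeasure (density M s') A"
proof -
  have "emeasure (density M s) A \<le> (\<integral>\<^sup>+x. c * (s' x * indicator A x) \<partial>M)"
    using le by (auto simp: emeasure_density indicator_def intro!: nn_integral_mono)
  also have "\<dots> = c * emeasure (density M s') A"
    by (simp add: nn_integral_cmult emeasure_density)
  finally show ?thesis .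
qed

lemma density_in_dists:
  assumes P0: "P0 \<in> dists" and s: "integrable P0 s" "\<And>x. 0 \<le> s x" "integral\<^sup>L P0 s = 1"
  shows "density P0 (\<lambda>x. ennreal (s x)) \<in> dists"
proof -
  have "emeasure (density P0 (\<lambda>x. ennreal (s x))) (space P0) = (\<integral>\<^sup>+x. ennreal (s x) \<partial>P0)"
    using s by (subst emeasure_density) (auto intro!: nn_integral_cong)
  also have "\<dots> = 1"
    using s by (subst nn_integral_eq_integral) auto
  finally show ?thesis
    using distsD[OF P0] by (auto simp: dists_def intro!: prob_spaceI)
qed

locale clipped_sampler =
  fixes g eps :: real and p0 :: "'a::euclidean_space \<Rightarrow> real"
  assumes g: "1 \<le> g" and eps: "0 \<le> eps"
    and p0 [measurable]: "p0 \<in> borel_measurable borel" and p0_nonneg: "\<And>x. 0 \<le> p0 x"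
    and prob_P0: "prob_space (density lborel (\<lambda>x. ennreal (p0 x)))"
begin

definition P0 :: "'a measure" where
  "P0 = density lborel (\<lambda>x. ennreal (p0 x))"

definition a :: real where
  "a = (g + 1) / (g + exp eps)"

definition b :: real where
  "b = (g + 1) * exp eps / (g + exp eps)"

lemma P0_in_dists: "P0 \<in> dists"
  using prob_P0 by (simp add: P0_def dists_def)

sublocale P0: prob_space P0
  using distsD[OF P0_in_dists] by simp

text \<open>The relation \<open>b = exp eps * a\<close> is the source of privacy. The relation
  \<open>g * a + b = g + 1\<close> says that a density equal to \<open>b\<close> on mass
  \<open>1 / (g + 1)\<close> and to \<open>a\<close> elsewhere has total mass one.\<close>

lemma clip_consts: "0 < a" "a \<le> 1" "1 \<le> b" "a \<le> b" "b = exp eps * a" "g * a + b = g + 1"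
proof -
  have E: "1 \<le> exp eps" using eps by simp
  show ab: "0 < a" "a \<le> 1" "1 \<le> b" "b = exp eps * a"
    using E g mult_left_mono[OF E, of g] by (simp_all add: a_def b_def field_simps add_nonneg_pos)
  show "a \<le> b" using ab(2,3) by linarith
  have "g * a + b = a * (g + exp eps)" using ab by (simp add: algebra_simps)
  also have "\<dots> = g + 1" using g by (simp add: a_def add_nonneg_pos less_imp_neq[symmetric])
  finally show "g * a + b = g + 1" .
qed

lemma Ngamma_Qstar:
  assumes "P \<in> Ngamma g P0"
  obtains t r where "t \<in> borel_measurable borel" "P = density P0 (\<lambda>x. ennreal (t x))"
    "AE x in P0. 1 / g \<le> t x \<and> t x \<le> g" "integral\<^sup>L P0 t = 1"
    "0 < r" "(\<integral>x. clip (t x / r) a b \<partial>P0) = 1"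
    "Qstar g eps p0 P = density P0 (\<lambda>x. ennreal (clip (t x / r) a b))"
proof -
  have "0 < g" using g by simp
  then obtain t where t: "t \<in> borel_measurable borel" "\<And>x. 0 \<le> t x" "P = density P0 (\<lambda>x. ennreal (t x))"
    "AE x in P0. 1 / g \<le> t x \<and> t x \<le> g" "integral\<^sup>L P0 t = 1"
    using Ngamma_density[OF P0_in_dists _ assms] by blast
  obtain r where "0 < r" "(\<integral>x. clip (t x / r) a b \<partial>P0) = 1"
    "Qstar g eps p0 P = density P0 (\<lambda>x. ennreal (clip (t x / r) a b))"
    using Qstar_density[OF p0 p0_nonneg prob_P0 g eps t(1,2) t(4)[unfolded P0_def]]
    unfolding t(3) P0_def a_def b_def by blast
  with t show thesis by (intro that)
qed

lemma borel_measurable_P0: "h \<in> borel_measurable borel \<Longrightarrow> h \<in> borel_measurable P0"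
  by (simp add: P0_def)

lemma Qstar_in_dists:
  assumes "P \<in> Ngamma g P0"
  shows "Qstar g eps p0 P \<in> dists"
proof -
  obtain t r where t: "t \<in> borel_measurable borel" "(\<integral>x. clip (t x / r) a b \<partial>P0) = 1"
    and eq: "Qstar g eps p0 P = density P0 (\<lambda>x. ennreal (clip (t x / r) a b))"
    using Ngamma_Qstar[OF assms] by blast
  note [measurable] = borel_measurable_P0[OF t(1)]
  have "0 \<le> clip y a b" for y
    using clip_consts clip_bounds(1)[of a b y] by linarith
  then show ?thesis
    unfolding eq using t(2) clip_consts
    by (intro density_in_dists[OF P0_in_dists] P0.integrable_clip) auto
qed

text \<open>Whatever the inputs, both output densities lie between \<open>a\<close> and
  \<open>exp eps * a\<close>, so they compare pointwise.\<close>

lemma Qstar_LDP: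
  assumes "P \<in> Ngamma g P0" "P' \<in> Ngamma g P0" and A: "A \<in> sets borel"
  shows "emeasure (Qstar g eps p0 P) A \<le> ennreal (exp eps) * emeasure (Qstar g eps p0 P') A"
proof -
  obtain t r where t: "t \<in> borel_measurable borel"
    and eq: "Qstar g eps p0 P = density P0 (\<lambda>x. ennreal (clip (t x / r) a b))"
    using Ngamma_Qstar[OF assms(1)] by blast
  obtain t' r' where t': "t' \<in> borel_measurable borel"
    and eq': "Qstar g eps p0 P' = density P0 (\<lambda>x. ennreal (clip (t' x / r') a b))"
    using Ngamma_Qstar[OF assms(2)] by blast
  note [measurable] = t t'
  have "clip y a b \<le> exp eps * clip y' a b" for y y'
  proof -
    have "clip y a b \<le> exp eps * a" using clip_consts clip_bounds(2)[of a b y] by simp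
    also have "\<dots> \<le> exp eps * clip y' a b"
      using clip_consts by (intro mult_left_mono clip_bounds) auto
    finally show ?thesis .
  qed
  moreover have "0 \<le> clip y a b" for y
    using clip_consts clip_bounds(1)[of a b y] by linarith
  ultimately show ?thesis
    unfolding eq eq' using A
    by (intro density_le_density) (auto simp: P0_def ennreal_leI simp flip: ennreal_mult)
qed

text \<open>The separating line has integral one, so the clipped means at \<open>m'\<close> and
  \<open>m\<close> lie on either side of one and \<open>clip_ratio_bounds\<close> applies. The chord
  of \<open>f\<close> over \<open>[m, m']\<close>, taken at 1, gives the bound. The parameters are
  kept free so that \<open>m = m' = 1\<close> covers the regime where the sampler returns its
  input.\<close>

lemma Df_Qstar_le:
  assumes P: "P \<in> Ngamma g P0" and f: "convex_on {0<..} f"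
    and mM: "0 < m" "m \<le> m'" and w: "w * m' + (1 - w) * m = 1"
    and ends: "m * a \<le> 1 / g" "g \<le> m' * b"
    and chord: "\<And>y. 1 / g \<le> y \<Longrightarrow> y \<le> g \<Longrightarrow> clip (y / m') a b \<le> h + k * (y - 1 / g)"
      "\<And>y. 1 / g \<le> y \<Longrightarrow> y \<le> g \<Longrightarrow> h + k * (y - 1 / g) \<le> clip (y / m) a b"
      "h + k * (1 - 1 / g) = 1"
  shows "Df f P (Qstar g eps p0 P) \<le> ereal (w * f m' + (1 - w) * f m)"
proof -
  obtain t r where t: "t \<in> borel_measurable borel" "P = density P0 (\<lambda>x. ennreal (t x))"
      "AE x in P0. 1 / g \<le> t x \<and> t x \<le> g" "integral\<^sup>L P0 t = 1"
    and r: "0 < r" "(\<integral>x. clip (t x / r) a b \<partial>P0) = 1"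
    and eq: "Qstar g eps p0 P = density P0 (\<lambda>x. ennreal (clip (t x / r) a b))"
    using Ngamma_Qstar[OF P] by blast
  note [measurable] = borel_measurable_P0[OF t(1)]
  note ab = clip_consts
  have t_int: "integrable P0 t"
  proof (rule P0.integrable_const_bound[where B = g])
    show "AE x in P0. norm (t x) \<le> g"
      using t(3)
    proof eventually_elim
      case (elim x)
      moreover have "0 \<le> 1 / g" using g by simp
      ultimately show ?case by (simp only: real_norm_def) linarith
    qed
  qed simp
  have chord_int: "integrable P0 (\<lambda>x. h + k * (t x - 1 / g))" "(\<integral>x. h + k * (t x - 1 / g) \<partial>P0) = 1"
    using t_int t(4) chord(3) P0.prob_space by (simp_all)
  have int: "integrable P0 (\<lambda>x. clip (t x / s) a b)" for s
    using ab by (intro P0.integrable_clip) auto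
  have "(\<integral>x. clip (t x / m') a b \<partial>P0) \<le> (\<integral>x. h + k * (t x - 1 / g) \<partial>P0)"
    using t(3) by (intro integral_mono_AE int chord_int, eventually_elim) (simp add: chord)
  moreover have "(\<integral>x. h + k * (t x - 1 / g) \<partial>P0) \<le> (\<integral>x. clip (t x / m) a b \<partial>P0)"
    using t(3) by (intro integral_mono_AE int chord_int, eventually_elim) (simp add: chord)
  ultimately have "AE x in P0. m \<le> t x / clip (t x / r) a b \<and> t x / clip (t x / r) a b \<le> m'"
    using ab(1,4) mM ends r t(3) g
    by (intro P0.clip_ratio_bounds[where g = g]) (auto simp: chord_int)
  \<comment> \<open>If \<open>m = m'\<close>, division by zero makes the slope 0 and the bound reads
    \<open>f m\<close>, as it should.\<close>
  then have le: "AE x in P0. f (t x / clip (t x / r) a b) \<le>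
      (f m' - f m) / (m' - m) * (t x / clip (t x / r) a b) + (f m - (f m' - f m) / (m' - m) * m)"
  proof eventually_elim
    case (elim x)
    have "convex_on {m..m'} f"
      by (rule convex_on_subset[OF f]) (use mM in auto)
    from convex_onD_Icc'[OF this, of "t x / clip (t x / r) a b"] elim
    show ?case by (simp add: algebra_simps)
  qed
  have pos: "AE x in P0. 0 < t x \<and> 0 < clip (t x / r) a b"
    using t(3)
  proof eventually_elim
    case (elim x)
    moreover have "0 < 1 / g" using g by simp
    ultimately show ?case using ab clip_bounds(1)[of a b "t x / r"] by linarith
  qed
  have "Df f P (Qstar g eps p0 P) \<le>
      ereal ((f m' - f m) / (m' - m) + (f m - (f m' - f m) / (m' - m) * m))"
    using P by (intro Df_density_le[OF P0.sigma_finite_measure_axioms _ Qstar_in_dists[OF P] _ t(2) _ eq pos le])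
      (auto simp: Ngamma_def)
  also have "(f m' - f m) / (m' - m) + (f m - (f m' - f m) / (m' - m) * m) = w * f m' + (1 - w) * f m"
  proof (cases "m = m'")
    case False
    have "1 - m = w * (m' - m)" using w by (simp add: algebra_simps)
    then have "(f m' - f m) / (m' - m) * (1 - m) = w * (f m' - f m)"
      using False by simp
    moreover have "x + (y - x * m) = y + x * (1 - m)" for x y :: real
      by (simp add: algebra_simps)
    ultimately show ?thesis by (simp only:) (simp add: algebra_simps)
  qed (simp add: algebra_simps)
  finally show ?thesis .
qed

end

section \<open>The minimax value\<close>

text \<open>Tangent slopes increase with the base point, so on positive base points the intercepts
  decrease. The resulting \<open>d1 \<le> d2\<close> makes the bound of \<open>Df_ge\<close>
  nonincreasing in the mass that \<open>Q\<close> gives to \<open>A\<close>, so an upper bound on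
  that mass suffices.\<close>

lemma convex_tangent_pair:
  fixes f :: "real \<Rightarrow> real"
  assumes f: "convex_on {0<..} f" and mM: "0 < m" "m \<le> m'"
  obtains c1 d1 c2 d2 where "\<And>u. 0 < u \<Longrightarrow> c1 * u + d1 \<le> f u" "\<And>u. 0 < u \<Longrightarrow> c2 * u + d2 \<le> f u"
    "c1 * m' + d1 = f m'" "c2 * m + d2 = f m" "d1 \<le> d2"
proof -
  obtain k where k: "\<And>x u. 0 < x \<Longrightarrow> 0 < u \<Longrightarrow> f x + k x * (u - x) \<le> f u"
    using convex_support_lines[OF f] by blast
  have 1: "f m' + k m' * (m - m') \<le> f m" and 2: "f m + k m * (m' - m) \<le> f m'"
    using k mM by auto
  have "k m \<le> k m'"
  proof (cases "m = m'")
    case False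
    have "k m * (m' - m) \<le> k m' * (m' - m)" using 1 2 by (simp add: algebra_simps)
    then show ?thesis using False mM by (simp add: mult_le_cancel_right)
  qed simp
  then have "k m * m \<le> k m' * m" using mM by (intro mult_right_mono) auto
  with 1 have "f m' - k m' * m' \<le> f m - k m * m" by (simp add: algebra_simps)
  then show thesis
    using k mM by (intro that[of "k m'" "f m' - k m' * m'" "k m" "f m - k m * m"])
      (auto simp: algebra_simps)
qed

section \<open>Hard instances and the lower bound\<close>

context clipped_sampler
begin

text \<open>The levels \<open>g\<close> on \<open>A\<close> and \<open>1 / g\<close> off
  \<open>A\<close> contribute \<open>g / (g + 1)\<close> and \<open>1 / (g + 1)\<close>, which add
  up to one.\<close>

lemma two_level_in_Ngamma:
  assumes A: "A \<in> sets borel" and mass: "measure P0 A = 1 / (g + 1)"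
  defines "P \<equiv> density P0 (\<lambda>x. ennreal (1 / g + (g - 1 / g) * indicator A x))"
  shows "P \<in> Ngamma g P0" "measure P A = g / (g + 1)"
proof -
  define t where "t x = 1 / g + (g - 1 / g) * indicator A x" for x :: 'a
  have P: "P = density P0 (\<lambda>x. ennreal (t x))" by (simp add: P_def t_def)
  have [measurable]: "A \<in> sets P0" using A by (simp add: P0_def)
  have inv: "0 < 1 / g" "1 / g \<le> g" using g by (auto simp: field_simps mult_ge1_I)
  have ind: "integrable P0 (indicator A :: 'a \<Rightarrow> real)" "integral\<^sup>L P0 (indicator A) = 1 / (g + 1)"
    using mass by (auto simp: P0.emeasure_eq_measure)
  have t_int: "integrable P0 t" unfolding t_def using ind by simp
  have "integral\<^sup>L P0 t = 1 / g + (g - 1 / g) * (1 / (g + 1))"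
    unfolding t_def using ind P0.prob_space by simp
  also have "g - 1 / g = (g + 1) * (1 - 1 / g)"
    using g by (simp add: algebra_simps add_divide_distrib)
  also have "1 / g + (g + 1) * (1 - 1 / g) * (1 / (g + 1)) = 1"
    using g by simp
  finally have t_1: "integral\<^sup>L P0 t = 1" .
  have bounds: "1 / g \<le> t x" "t x \<le> g" for x
    using inv by (auto simp: t_def indicator_def)
  have "0 \<le> t x" for x using bounds(1)[of x] inv by linarith
  then have "P \<in> dists"
    unfolding P by (intro density_in_dists P0_in_dists t_int t_1)
  then show "P \<in> Ngamma g P0"
    unfolding P using t_int bounds by (intro density_in_Ngamma P0_in_dists) (auto dest: distsD)
  have "emeasure P A = (\<integral>\<^sup>+x. ennreal g * indicator A x \<partial>P0)"
    unfolding P using t_int by (subst emeasure_density) (auto simp: t_def indicator_def intro!: nn_integral_cong)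
  also have "\<dots> = ennreal (g * (1 / (g + 1)))"
    using g mass by (simp add: nn_integral_cmult P0.emeasure_eq_measure ennreal_mult del: times_divide_eq_right)
  finally show "measure P A = g / (g + 1)"
    using g by (simp add: measure_def)
qed

lemma samplers_in_dists: "Q \<in> samplers Pt eps \<Longrightarrow> P \<in> Pt \<Longrightarrow> Q P \<in> dists"
  by (simp add: samplers_def)

text \<open>Otherwise each \<open>Q (P k)\<close> gives \<open>A k\<close> more than
  \<open>exp eps / (g + exp eps)\<close>. By privacy \<open>Q (P 0)\<close> then gives each of the
  \<open>n\<close> sets with \<open>k > 0\<close> at least \<open>1 / (g + exp eps)\<close>, while
  \<open>A 0\<close> is measured without the privacy loss. The total exceeds one, although the sets
  cover the space disjointly.\<close>

lemma hard_instance: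
  assumes g_nat: "g = real n" and Q: "Q \<in> samplers Pt eps" and N: "Ngamma g P0 \<subseteq> Pt"
  obtains A P where "A \<in> sets borel" "P \<in> Ngamma g P0" "measure P A = g / (g + 1)"
    "measure (Q P) A \<le> exp eps / (g + exp eps)"
proof -
  have "absolutely_continuous lborel P0"
    unfolding P0_def by (rule absolutely_continuousI_density) simp
  then obtain B :: "nat \<Rightarrow> 'a set" where B: "\<And>k. B k \<in> sets borel" "\<And>k. B k \<subseteq> B (Suc k)"
    "B 0 = {}" "B (Suc n) = UNIV" "\<And>k. k \<le> Suc n \<Longrightarrow> measure P0 (B k) = k / Suc n"
    using equal_mass_chain[OF P0_in_dists, of "Suc n"] by auto
  define A where "A k = B (Suc k) - B k" for k
  define P where "P k = density P0 (\<lambda>x. ennreal (1 / g + (g - 1 / g) * indicator (A k) x))" for k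
  have A: "A k \<in> sets borel" for k using B by (auto simp: A_def)
  have measure_A: "measure M (A k) = measure M (B (Suc k)) - measure M (B k)" if "M \<in> dists" for M k
    using distsD[OF that] B by (simp add: A_def finite_measure.finite_measure_Diff)
  have "measure P0 (A k) = 1 / (g + 1)" if "k \<le> n" for k
    using that B(5)[of k] B(5)[of "Suc k"]
    by (simp add: measure_A[OF P0_in_dists] g_nat add_divide_distrib algebra_simps)
  then have P: "P k \<in> Ngamma g P0" "measure (P k) (A k) = g / (g + 1)" if "k \<le> n" for k
    unfolding P_def using two_level_in_Ngamma[OF A] that by auto
  have QP: "Q (P k) \<in> dists" if "k \<le> n" for k
    using Q P(1)[OF that] N by (auto intro: samplers_in_dists)
  have Q_LDP: "\<forall>P\<in>Pt. \<forall>P'\<in>Pt. \<forall>A\<in>sets borel.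
      emeasure (Q P) A \<le> ennreal (exp eps) * emeasure (Q P') A"
    using Q by (simp add: samplers_def)
  have LDP: "measure (Q (P k)) C \<le> exp eps * measure (Q (P 0)) C" if "k \<le> n" "C \<in> sets borel" for k C
  proof -
    have fin: "finite_measure (Q (P k))" "finite_measure (Q (P 0))"
      using distsD(2)[OF QP] that(1) by auto
    have "emeasure (Q (P k)) C \<le> ennreal (exp eps) * emeasure (Q (P 0)) C"
      using Q_LDP P(1)[OF that(1)] P(1)[of 0] N that(2) by (meson le0 subsetD)
    then show ?thesis
      by (simp add: finite_measure.emeasure_eq_measure[OF fin(1)]
          finite_measure.emeasure_eq_measure[OF fin(2)] flip: ennreal_mult)
  qed
  have "\<exists>k\<le>n. measure (Q (P k)) (A k) \<le> exp eps / (g + exp eps)"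
  proof (rule ccontr)
    assume "\<not> ?thesis"
    then have big: "exp eps / (g + exp eps) < measure (Q (P k)) (A k)" if "k \<le> n" for k
      using that by (meson not_le)
    have "1 / (g + exp eps) \<le> measure (Q (P 0)) (A (Suc k))" if "k < n" for k
    proof -
      have "exp eps * (1 / (g + exp eps)) \<le> exp eps * measure (Q (P 0)) (A (Suc k))"
        using big[of "Suc k"] LDP[of "Suc k" "A (Suc k)"] A that by simp
      then show ?thesis by (subst (asm) mult_le_cancel_left_pos) auto
    qed
    then have "(\<Sum>k<n. 1 / (g + exp eps)) \<le> (\<Sum>k<n. measure (Q (P 0)) (A (Suc k)))"
      by (intro sum_mono) auto
    moreover have "(\<Sum>k<Suc n. measure (Q (P 0)) (A k)) = 1"
      unfolding measure_A[OF QP[of 0, simplified]]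
      using prob_space.prob_space[OF distsD(1)[OF QP[of 0]]] distsD(4)[OF QP[of 0]] B
      by (subst sum_lessThan_telescope) simp
    ultimately have "exp eps / (g + exp eps) + g / (g + exp eps) < 1"
      using big[of 0] by (simp add: sum.lessThan_Suc_shift g_nat del: sum.lessThan_Suc)
    moreover have "exp eps / (g + exp eps) + g / (g + exp eps) = 1"
      using g by (simp add: add_nonneg_pos less_imp_neq[symmetric] flip: add_divide_distrib)
    ultimately show False by simp
  qed
  then obtain k where "k \<le> n" "measure (Q (P k)) (A k) \<le> exp eps / (g + exp eps)" by blast
  then show thesis using A P by (intro that[of "A k" "P k"]) auto
qed

lemma minimax_value:
  assumes g_nat: "g = real n" and f: "convex_on {0<..} f" "f 1 = 0"
  obtains V where "\<And>P. P \<in> Ngamma g P0 \<Longrightarrow> Df f P (Qstar g eps p0 P) \<le> ereal V"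
    "\<And>Q Pt. Q \<in> samplers Pt eps \<Longrightarrow> Ngamma g P0 \<subseteq> Pt \<Longrightarrow> \<exists>P\<in>Ngamma g P0. ereal V \<le> Df f P (Q P)"
proof (cases "b \<le> g\<^sup>2 * a")
  case True
  \<comment> \<open>On a hard instance with set \<open>A\<close> of mass \<open>1 / (g + 1)\<close>,
    the sampler has density \<open>b\<close> on \<open>A\<close> and \<open>a\<close> off it. So
    \<open>m'\<close> and \<open>m\<close> are the density ratios on and off \<open>A\<close>, and
    \<open>w\<close> is the output mass of \<open>A\<close>.\<close>
  define m where "m = 1 / (g * a)"
  define m' where "m' = g / b"
  define w where "w = exp eps / (g + exp eps)"
  note ab = clip_consts
  have g0: "0 < g" "0 < g + exp eps" using g by (auto intro: add_pos_pos)
  have m_pos: "0 < m" using g0 ab by (simp add: m_def)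
  have "m = g / (g\<^sup>2 * a)" using g0 by (simp add: m_def power2_eq_square)
  also have "\<dots> \<le> m'"
    unfolding m'_def using True g0 ab by (intro divide_left_mono) auto
  finally have mM: "0 < m" "m \<le> m'" using m_pos by auto
  have "1 - w = g / (g + exp eps)"
    using g0 by (simp add: w_def diff_divide_eq_iff)
  then have w: "w * m' = g / (g + 1)" "(1 - w) * m = 1 / (g + 1)"
    using g0 by (simp_all add: w_def m_def m'_def a_def b_def)
  have sum1: "w * m' + (1 - w) * m = 1"
    unfolding w using g0 by (simp flip: add_divide_distrib)
  show thesis
  proof (rule that)
    fix P assume P: "P \<in> Ngamma g P0"
    obtain k where k: "a + k * (1 - 1 / g) = 1"
      "\<And>y. 1 / g \<le> y \<Longrightarrow> y \<le> g \<Longrightarrow> clip (y / m') a b \<le> a + k * (y - 1 / g)"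
      "\<And>y. 1 / g \<le> y \<Longrightarrow> y \<le> g \<Longrightarrow> a + k * (y - 1 / g) \<le> clip (y / m) a b"
      using clip_chord[OF g ab(1,4) True ab(6)] unfolding m_def m'_def by blast
    show "Df f P (Qstar g eps p0 P) \<le> ereal (w * f m' + (1 - w) * f m)"
      using g0 ab
      by (intro Df_Qstar_le[OF P f(1) mM sum1 _ _ k(2,3,1)]) (auto simp: m_def m'_def)
  next
    fix Q Pt assume Q: "Q \<in> samplers Pt eps" and N: "Ngamma g P0 \<subseteq> Pt"
    obtain A P where AP: "A \<in> sets borel" "P \<in> Ngamma g P0" "measure P A = g / (g + 1)"
      "measure (Q P) A \<le> w"
      using hard_instance[OF g_nat Q N] unfolding w_def by blast
    have QP: "Q P \<in> dists"
      using AP(2) N by (intro samplers_in_dists[OF Q]) auto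
    obtain c1 d1 c2 d2 where lines: "\<And>u. 0 < u \<Longrightarrow> c1 * u + d1 \<le> f u" "\<And>u. 0 < u \<Longrightarrow> c2 * u + d2 \<le> f u"
      "c1 * m' + d1 = f m'" "c2 * m + d2 = f m" "d1 \<le> d2"
      using convex_tangent_pair[OF f(1) mM] by blast
    have P_w: "measure P A = w * m'" "1 - measure P A = (1 - w) * m"
      using AP(3) w sum1 by linarith+
    have "(d2 - d1) * measure (Q P) A \<le> (d2 - d1) * w"
      using AP(4) lines(5) by (intro mult_left_mono) auto
    \<comment> \<open>Tangency at \<open>m'\<close> and \<open>m\<close> makes the lower bound equal
      to the upper one when the output mass of \<open>A\<close> is exactly \<open>w\<close>.\<close>
    moreover have "w * f m' + (1 - w) * f m = c1 * (w * m') + d1 * w + c2 * ((1 - w) * m) + d2 * (1 - w)"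
      unfolding lines(3,4)[symmetric] by (simp add: algebra_simps)
    ultimately have "w * f m' + (1 - w) * f m \<le> c1 * measure P A + d1 * measure (Q P) A
        + c2 * (1 - measure P A) + d2 * (1 - measure (Q P) A)"
      unfolding P_w(2) unfolding P_w(1) by (simp add: algebra_simps)
    also have "ereal \<dots> \<le> Df f P (Q P)"
      using AP QP by (intro Df_ge f lines(1,2)) (auto simp: Ngamma_def)
    finally show "\<exists>P\<in>Ngamma g P0. ereal (w * f m' + (1 - w) * f m) \<le> Df f P (Q P)"
      using AP by auto
  qed
next
  case False
  note ab = clip_consts
  have g0: "0 < g" "0 < g + exp eps" using g by (auto intro: add_pos_pos)
  have "g\<^sup>2 * a < exp eps * a" using False ab by simp
  then have E: "g\<^sup>2 < exp eps" using ab by simp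
  \<comment> \<open>The range of \<open>t\<close> now lies inside the clipping interval, so clipping
    at \<open>r = 1\<close> changes nothing and the separating line is the identity.\<close>
  have ends: "a \<le> 1 / g" "g \<le> b"
    using E g0 by (simp_all add: a_def b_def pos_le_divide_eq pos_divide_le_eq algebra_simps power2_eq_square)
  have clip_id: "clip y a b = y" if "1 / g \<le> y" "y \<le> g" for y
    using that ends by (auto simp: clip_def)
  show thesis
  proof (rule that)
    fix P assume P: "P \<in> Ngamma g P0"
    have "Df f P (Qstar g eps p0 P) \<le> ereal (1 * f 1 + (1 - 1) * f 1)"
      using ends by (intro Df_Qstar_le[OF P f(1), where h = "1 / g" and k = 1]) (auto simp: clip_id)
    then show "Df f P (Qstar g eps p0 P) \<le> ereal 0" using f by simp
  next
    fix Q Pt assume Q: "Q \<in> samplers Pt eps" and N: "Ngamma g P0 \<subseteq> Pt"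
    obtain P where P: "P \<in> Ngamma g P0"
      \<comment> \<open>Here it only witnesses that the neighbourhood is nonempty.\<close>
      using hard_instance[OF g_nat Q N] by blast
    then have QP: "Q P \<in> dists"
      using N by (intro samplers_in_dists[OF Q]) auto
    obtain k where k: "\<And>x u. 0 < x \<Longrightarrow> 0 < u \<Longrightarrow> f x + k x * (u - x) \<le> f u"
      using convex_support_lines[OF f(1)] by blast
    define c where "c = k 1"
    define d where "d = f 1 - k 1"
    have line: "\<And>u. 0 < u \<Longrightarrow> c * u + d \<le> f u" "c + d = f 1"
      using k[of 1] by (simp_all add: c_def d_def algebra_simps)
    \<comment> \<open>With the empty set, \<open>Df_ge\<close> integrates a single tangent at 1,
      which gives \<open>c + d = f 1 = 0\<close>.\<close>
    have "ereal (c * measure P {} + d * measure (Q P) {} + c * (1 - measure P {}) + d * (1 - measure (Q P) {}))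
        \<le> Df f P (Q P)"
      using P QP by (intro Df_ge f line(1)) (auto simp: Ngamma_def)
    then show "\<exists>P\<in>Ngamma g P0. ereal 0 \<le> Df f P (Q P)"
      using P line(2) f by auto
  qed
qed

end

theorem theorem5:
  fixes g :: nat and p0 :: "'a::euclidean_space \<Rightarrow> real" and eps :: real
    and Pt :: "'a measure set" and f :: "real \<Rightarrow> real" and hat :: "'a measure \<Rightarrow> 'a measure"
  defines "P0 \<equiv> density lborel (\<lambda>x. ennreal (p0 x))"
  defines "N \<equiv> Ngamma (real g) P0"
  assumes "g \<ge> 1"
    and "p0 \<in> borel_measurable borel" and "\<forall>x. p0 x \<ge> 0" and "prob_space P0"
    and "eps \<ge> 0"
    and "Pt \<subseteq> dists" and "N \<subseteq> Pt"
    and "convex_on {0<..} f" and "f 1 = 0"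
    and "\<forall>P\<in>Pt - N. hat P \<in> N \<and> (\<forall>P'\<in>N. Df f P (hat P) \<le> Df f P P')"
  shows "(\<lambda>P. if P \<in> N then Qstar (real g) eps p0 P else Qstar (real g) eps p0 (hat P))
           \<in> samplers Pt eps
       \<and> (SUP P\<in>N. Df f P (if P \<in> N then Qstar (real g) eps p0 P else Qstar (real g) eps p0 (hat P)))
           = minimax Pt N eps f"
proof -
  interpret cs: clipped_sampler "real g" eps p0
    by (rule clipped_sampler.intro) (use assms(3-7) in \<open>simp_all add: P0_def\<close>)
  have N: "N = Ngamma (real g) (clipped_sampler.P0 p0)"
    by (simp add: N_def P0_def cs.P0_def)
  define S where "S P = (if P \<in> N then Qstar (real g) eps p0 P else Qstar (real g) eps p0 (hat P))" for P
  \<comment> \<open>Every output of the extended sampler is the output at some member of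
    \<open>N\<close>, namely \<open>P\<close> or \<open>hat P\<close>, so privacy on
    \<open>Pt\<close> reduces to privacy on \<open>N\<close>.\<close>
  have "\<exists>P'\<in>N. S P = Qstar (real g) eps p0 P'" if "P \<in> Pt" for P
    using assms(12) that by (auto simp: S_def)
  then obtain c where c: "\<And>P. P \<in> Pt \<Longrightarrow> c P \<in> N \<and> S P = Qstar (real g) eps p0 (c P)"
    by metis
  have S: "S \<in> samplers Pt eps"
    unfolding samplers_def mem_Collect_eq
  proof (intro conjI ballI)
    show "S P \<in> dists" if "P \<in> Pt" for P
      using c[OF that] cs.Qstar_in_dists by (simp add: N)
    show "emeasure (S P) A \<le> ennreal (exp eps) * emeasure (S P') A"
      if "P \<in> Pt" "P' \<in> Pt" "A \<in> sets borel" for P P' A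
      using c[OF that(1)] c[OF that(2)] cs.Qstar_LDP[of "c P" "c P'" A] that(3) by (simp add: N)
  qed
  obtain V where upper: "\<And>P. P \<in> N \<Longrightarrow> Df f P (Qstar (real g) eps p0 P) \<le> ereal V"
    and lower: "\<And>Q Pt. Q \<in> samplers Pt eps \<Longrightarrow> N \<subseteq> Pt \<Longrightarrow> \<exists>P\<in>N. ereal V \<le> Df f P (Q P)"
    using cs.minimax_value[OF refl assms(10,11)] unfolding N by blast
  have "(SUP P\<in>N. Df f P (S P)) \<le> ereal V"
    using upper by (auto intro!: SUP_least simp: S_def)
  also have "ereal V \<le> minimax Pt N eps f"
    unfolding minimax_def
  proof (rule INF_greatest)
    fix Q assume "Q \<in> samplers Pt eps"
    then obtain P where "P \<in> N" "ereal V \<le> Df f P (Q P)"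
      using lower assms(9) by blast
    then show "ereal V \<le> (SUP P\<in>N. Df f P (Q P))"
      by (rule SUP_upper2)
  qed
  finally have "(SUP P\<in>N. Df f P (S P)) \<le> minimax Pt N eps f" .
  moreover have "minimax Pt N eps f \<le> (SUP P\<in>N. Df f P (S P))"
    unfolding minimax_def using S by (rule INF_lower)
  ultimately show ?thesis
    using S unfolding S_def[abs_def] by (intro conjI antisym)
qed

end
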